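(* Let $2\le m<n$ be integers and let $E=K(n,m,\mathcal D)$ be a self-affine carpet with distribution sequence $(a_j)_{j=0}^{m-1}$, and let $s=\#\{j:a_j>0\}$. Let $R$ be a basic rectangle of rank $k\ge1$ of $E$, let $p\ge0$ be an integer, and let $\delta=1/n^{k+p}$. Then $$C_2^{-1}\,\mu_E(R)\,\delta^{-\dim_B E}\le N_\delta(R\cap E)\le C_2\,\mu_E(R)\,\delta^{-\dim_B E},$$ where $C_2=2s(m+2)$.
   Context: For integers $2\le m<n$ and a non-empty digit set $\mathcal D\subset\{0,1,\dots,n-1\}\times\{0,1,\dots,m-1\}$, let $S_d(z)=\mathrm{diag}(n^{-1},m^{-1})(z+d)$ for $d\in\mathcal D$, $z\in\mathbb R^2$. The self-affine carpet $E=K(n,m,\mathcal D)$ is the unique non-empty compact set with $E=\bigcup_{d\in\mathcal D}S_d(E)$. The distribution sequence of $\mathcal D$ is $(a_j)_{j=0}^{m-1}$, $a_j=\#\{i:(i,j)\in\mathcal D\}$. For $\mathbf i=d_1\cdots d_k\in\mathcal D^k$ put $S_{\mathbf i}=S_{d_1}\circ\cdots\circ S_{d_k}$; the set $S_{\mathbf i}([0,1]^2)$ is called a basic rectangle of rank $k$. The uniform Bernoulli measure $\mu_E$ is the unique Borel probability measure on $E$ satisfying $\mu_E=\sum_{d\in\mathcal D}\frac{1}{\#\mathcal D}\,\mu_E\circ S_d^{-1}$ (regarded as a Borel measure on $\mathbb R^2$ supported on $E$). For $\delta>0$, a $\delta$-mesh-box in $\mathbb R^2$ is a set $\delta(z+[0,1]^2)$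 with $z\in\mathbb Z^2$, and for a bounded set $A\subset\mathbb R^2$, $N_\delta(A)$ is the number of $\delta$-mesh-boxes intersecting $A$. $\dim_B$ denotes box dimension; it is known that $\dim_B E=\log_n(N s^{1/\sigma-1})$ with $N=\#\mathcal D$, $\sigma=\log m/\log n$. *)

theory Defs
  imports "HOL-Probability.Probability"
begin

text \<open>The digit \<open>(i, j)\<close> selects column \<open>i\<close> (width \<open>1/n\<close>) and row \<open>j\<close> (height \<open>1/m\<close>).\<close>

definition carpet_digits :: "nat \<Rightarrow> nat \<Rightarrow> (nat \<times> nat) set \<Rightarrow> bool" where
  "carpet_digits n m D \<longleftrightarrow> D \<noteq> {} \<and> D \<subseteq> {0..<n} \<times> {0..<m}"

definition carpet_map :: "nat \<Rightarrow> nat \<Rightarrow> nat \<times> nat \<Rightarrow> real \<times> real \<Rightarrow> real \<times> real" where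
  "carpet_map n m d z = ((fst z + real (fst d)) / real n, (snd z + real (snd d)) / real m)"

text \<open>By Hutchinson's theorem exactly one set \<open>E\<close> satisfies this predicate when \<open>n, m \<ge> 2\<close> and
  \<open>D\<close> is a digit set; it is the carpet \<open>K(n, m, D)\<close>.\<close>

definition is_carpet :: "nat \<Rightarrow> nat \<Rightarrow> (nat \<times> nat) set \<Rightarrow> (real \<times> real) set \<Rightarrow> bool" where
  "is_carpet n m D E \<longleftrightarrow> E \<noteq> {} \<and> compact E \<and> E = (\<Union>d\<in>D. carpet_map n m d ` E)"

definition distribution_seq :: "(nat \<times> nat) set \<Rightarrow> nat \<Rightarrow> nat" where
  "distribution_seq D j = card {i. (i, j) \<in> D}"

text \<open>\<open>carpet_word_map n m [d1, \<dots>, dk]\<close> is \<open>S d1 \<circ> \<dots> \<circ> S dk\<close>.\<close>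

definition carpet_word_map :: "nat \<Rightarrow> nat \<Rightarrow> (nat \<times> nat) list \<Rightarrow> real \<times> real \<Rightarrow> real \<times> real" where
  "carpet_word_map n m ds = foldr (\<lambda>d f. carpet_map n m d \<circ> f) ds id"

definition basic_rectangle ::
    "nat \<Rightarrow> nat \<Rightarrow> (nat \<times> nat) set \<Rightarrow> nat \<Rightarrow> (real \<times> real) set \<Rightarrow> bool" where
  "basic_rectangle n m D k R \<longleftrightarrow>
     (\<exists>ds. length ds = k \<and> set ds \<subseteq> D \<and> R = carpet_word_map n m ds ` ({0..1} \<times> {0..1}))"

text \<open>The uniform Bernoulli measure of the carpet \<open>E\<close>, as a Borel measure on the plane carried by
  \<open>E\<close>; exactly one measure satisfies this predicate when \<open>E\<close> is the carpet of \<open>n, m, D\<close>.\<close>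

definition uniform_bernoulli_measure ::
    "nat \<Rightarrow> nat \<Rightarrow> (nat \<times> nat) set \<Rightarrow> (real \<times> real) set \<Rightarrow> (real \<times> real) measure \<Rightarrow> bool" where
  "uniform_bernoulli_measure n m D E \<mu> \<longleftrightarrow>
     prob_space \<mu> \<and> sets \<mu> = sets borel \<and> measure \<mu> E = 1 \<and>
     (\<forall>A\<in>sets borel.
        measure \<mu> A = (\<Sum>d\<in>D. 1 / real (card D) * measure \<mu> (carpet_map n m d -` A)))"

definition mesh_boxes :: "real \<Rightarrow> (real \<times> real) set set" where
  "mesh_boxes \<delta> =
     {(\<lambda>w. \<delta> *\<^sub>R ((real_of_int i, real_of_int j) + w)) ` ({0..1} \<times> {0..1}) | i j. True}"

definition mesh_count :: "real \<Rightarrow> (real \<times> real) set \<Rightarrow> nat" where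
  "mesh_count \<delta> A = card {B \<in> mesh_boxes \<delta>. B \<inter> A \<noteq> {}}"

text \<open>Meaningful only if the limit exists, as it does for every carpet.\<close>

definition box_dim :: "(real \<times> real) set \<Rightarrow> real" where
  "box_dim A = Lim (at_right 0) (\<lambda>\<delta>. ln (real (mesh_count \<delta> A)) / - ln \<delta>)"

end

theory Submission
  imports Defs
begin

text \<open>
Let \<open>N\<close> be the number of digits, \<open>q = k + p\<close>, so that \<open>\<delta> = n\<^sup>-\<^sup>q\<close>, and let \<open>t = q (log n / log m - 1)\<close>, so
that \<open>m\<^sup>q\<^sup>+\<^sup>t = n\<^sup>q\<close>. The box dimension makes \<open>\<delta> powr (- box_dim E)\<close> equal to \<open>N\<^sup>q s\<^sup>t\<close>, and the
measure of a basic rectangle of rank \<open>k\<close> is \<open>N\<^sup>-\<^sup>k\<close> (\<open>measure_basic_rectangle\<close>). So the claim compares the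
number of mesh boxes with \<open>N\<^sup>p s\<^sup>t\<close>. If \<open>l\<close> is the integer part of \<open>t\<close>, then \<open>N\<^sup>p s\<^sup>l\<close> is the number of
approximate squares in the rectangle: cells of width \<open>\<delta>\<close> and of height between \<open>\<delta>\<close> and
\<open>m \<delta>\<close> that are addressed by \<open>q\<close> digits followed by \<open>l\<close> used rows. Up to a factor at most \<open>s\<close> this is
\<open>N\<^sup>p s\<^sup>t\<close>.

For the lower bound (\<open>touched_lower\<close>), every approximate square contains a point of the carpet, and a
mesh box need not be charged for more than three of them.

For the upper bound (\<open>touched_upper\<close>), an approximate square meets at most three mesh columns and
\<open>m + 1\<close> mesh rows. The difficulty is that the rectangle is closed: it also contains points of the
carpet from neighbouring rectangles, on its boundary. In the coordinate across the common edge, all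
later digits of such a point are extreme. For a lateral neighbour this forces the rectangle to have
approximate squares of its own at its opposite end, so that the two lateral neighbours together
spoil at most two columns per height (\<open>card_near_columns\<close>); for neighbours above and below, the points lie on a line, which meets at
most two mesh rows. This gives at most \<open>(5 \<rho> s\<^sup>l + 10) N\<^sup>p\<close> boxes when \<open>p > 0\<close>, where
\<open>\<rho>\<close> bounds the number of mesh rows of a square. Comparison with the stated constant is easy for \<open>s \<ge> 3\<close>;
a carpet with \<open>s = 1\<close> lies on a line; and \<open>s = 2\<close> needs the estimates in \<open>two_row_budget\<close> and
\<open>two_row_budget_short\<close> (\<open>touched_upper_powr\<close>).

The box dimension itself comes from the same two estimates for the empty word, for which the
rectangle is the unit square (\<open>box_dim_eq\<close>).
\<close>

section \<open>Mesh boxes as index pairs\<close>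

text \<open>The mesh boxes are closed, so a point on the boundary of a box lies in up to four of them, and two
neighbouring boxes overlap. Counting is therefore done with index pairs: \<open>touched \<delta> A\<close> indexes
the mesh boxes that meet \<open>A\<close>, and \<open>strip \<delta> a b\<close> is the set of indices of closed mesh
intervals that meet the interval \<open>[a, b]\<close>.\<close>

definition touched :: "real \<Rightarrow> (real \<times> real) set \<Rightarrow> (int \<times> int) set" where
  "touched \<delta> A = {(c, r). \<exists>z\<in>A. of_int c * \<delta> \<le> fst z \<and> fst z \<le> (of_int c + 1) * \<delta> \<and>
                                of_int r * \<delta> \<le> snd z \<and> snd z \<le> (of_int r + 1) * \<delta>}"

definition strip :: "real \<Rightarrow> real \<Rightarrow> real \<Rightarrow> int set" where
  "strip \<delta> a b = {r. of_int r * \<delta> \<le> b \<and> a \<le> (of_int r + 1) * \<delta>}"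

lemma mesh_box_eq:
  fixes \<delta> :: real and i j :: int
  assumes "\<delta> > 0"
  shows "(\<lambda>w. \<delta> *\<^sub>R ((real_of_int i, real_of_int j) + w)) ` ({0..1} \<times> {0..1})
         = {z. of_int i * \<delta> \<le> fst z \<and> fst z \<le> (of_int i + 1) * \<delta> \<and>
             of_int j * \<delta> \<le> snd z \<and> snd z \<le> (of_int j + 1) * \<delta>}"
    (is "?f ` ?Q = ?B")
proof (intro subset_antisym subsetI)
  fix z assume "z \<in> ?f ` ?Q"
  then show "z \<in> ?B" using assms by (auto simp: algebra_simps)
next
  fix z assume z: "z \<in> ?B"
  let ?w = "(fst z / \<delta> - i, snd z / \<delta> - j)"
  have "?f ?w = z" using assms by (cases z) auto
  moreover have "?w \<in> ?Q" using assms z by (auto simp: field_simps)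
  ultimately show "z \<in> ?f ` ?Q" by (metis imageI)
qed

lemma mesh_count_eq_card_touched:
  assumes "\<delta> > 0"
  shows "mesh_count \<delta> A = card (touched \<delta> A)"
proof -
  define B where "B = (\<lambda>(i::int, j::int).
    {z. of_int i * \<delta> \<le> fst z \<and> fst z \<le> (of_int i + 1) * \<delta> \<and>
             of_int j * \<delta> \<le> snd z \<and> snd z \<le> (of_int j + 1) * \<delta>})"
  have mb: "mesh_boxes \<delta> = range B"
    unfolding mesh_boxes_def B_def using mesh_box_eq[OF assms] by auto
  have inj: "inj B"
  proof (rule injI)
    fix a b assume eq: "B a = B b"
    obtain i j where a: "a = (i, j)" by (cases a)
    obtain i' j' where b: "b = (i', j')" by (cases b)
    have "(of_int i * \<delta>, of_int j * \<delta>) \<in> B a" "(of_int i' * \<delta>, of_int j' * \<delta>) \<in> B b"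
      using assms by (auto simp: B_def a b algebra_simps)
    then have "(of_int i * \<delta>, of_int j * \<delta>) \<in> B b" "(of_int i' * \<delta>, of_int j' * \<delta>) \<in> B a"
      using eq by auto
    then have "i' \<le> i" "j' \<le> j" "i \<le> i'" "j \<le> j'"
      using assms by (auto simp: B_def a b)
    then show "a = b" by (simp add: a b)
  qed
  have "{C \<in> mesh_boxes \<delta>. C \<inter> A \<noteq> {}} = B ` touched \<delta> A"
    unfolding mb touched_def B_def by fastforce
  then show ?thesis
    unfolding mesh_count_def using inj by (simp add: card_image inj_on_subset)
qed

lemma card_int_between:
  fixes lo hi :: real
  assumes "hi - lo < real k"
  shows "finite {r::int. lo \<le> of_int r \<and> of_int r \<le> hi}" "card {r::int. lo \<le> of_int r \<and> of_int r \<le> hi} \<le> k"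
proof -
  have eq: "{r::int. lo \<le> of_int r \<and> of_int r \<le> hi} = {\<lceil>lo\<rceil>..\<lfloor>hi\<rfloor>}"
    by (auto simp: ceiling_le_iff le_floor_iff)
  show "finite {r::int. lo \<le> of_int r \<and> of_int r \<le> hi}" unfolding eq by simp
  have "real_of_int (\<lfloor>hi\<rfloor> - \<lceil>lo\<rceil>) < real k"
    using assms by (simp) linarith
  then have "\<lfloor>hi\<rfloor> - \<lceil>lo\<rceil> < int k" by linarith
  then show "card {r::int. lo \<le> of_int r \<and> of_int r \<le> hi} \<le> k" unfolding eq by simp
qed

text \<open>An index \<open>r\<close> lies in the strip iff it lies in the interval \<open>[a/\<delta> - 1, b/\<delta>]\<close>, whose length is
one more than that of \<open>[a, b]\<close> measured in mesh units.\<close>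

lemma card_strip:
  assumes "\<delta> > 0" and "(b - a) / \<delta> + 1 < real k"
  shows "finite (strip \<delta> a b)" "card (strip \<delta> a b) \<le> k"
proof -
  have eq: "strip \<delta> a b = {r. a / \<delta> - 1 \<le> of_int r \<and> of_int r \<le> b / \<delta>}"
    using assms(1) by (auto simp: strip_def field_simps)
  have "b / \<delta> - (a / \<delta> - 1) < real k" using assms(2) by (simp add: diff_divide_distrib)
  from card_int_between[OF this]
  show "finite (strip \<delta> a b)" "card (strip \<delta> a b) \<le> k" unfolding eq by auto
qed

text \<open>Passing to a coarser mesh cannot increase the count by more than a factor nine: a box of the finer mesh is
met by at most three columns and three rows of the coarser one. This reduces the box dimension to
the scales \<open>n\<^sup>-\<^sup>q\<close>.\<close>

lemma touched_coarser:
  assumes "0 < \<delta>'" and "\<delta>' \<le> \<delta>" and fin: "finite (touched \<delta>' A)"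
  shows "finite (touched \<delta> A)" "card (touched \<delta> A) \<le> 9 * card (touched \<delta>' A)"
proof -
  let ?S = "\<lambda>c::int. strip \<delta> (of_int c * \<delta>') ((of_int c + 1) * \<delta>')"
  have d: "\<delta> > 0" using assms by linarith
  have "((of_int c + 1) * \<delta>' - of_int c * \<delta>') / \<delta> + 1 < real 3" for c :: int
    using assms d by (simp add: field_simps)
  from card_strip[OF d this] have S: "finite (?S c)" "card (?S c) \<le> 3" for c by auto
  have sub: "touched \<delta> A \<subseteq> (\<Union>(c, r)\<in>touched \<delta>' A. ?S c \<times> ?S r)"
  proof
    fix b assume "b \<in> touched \<delta> A"
    then obtain c r z where b: "b = (c, r)" and z: "z \<in> A"
      "of_int c * \<delta> \<le> fst z" "fst z \<le> (of_int c + 1) * \<delta>"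
      "of_int r * \<delta> \<le> snd z" "snd z \<le> (of_int r + 1) * \<delta>"
      by (auto simp: touched_def)
    let ?c = "\<lfloor>fst z / \<delta>'\<rfloor>" and ?r = "\<lfloor>snd z / \<delta>'\<rfloor>"
    have *: "of_int ?c * \<delta>' \<le> fst z" "fst z \<le> (of_int ?c + 1) * \<delta>'"
    "of_int ?r * \<delta>' \<le> snd z" "snd z \<le> (of_int ?r + 1) * \<delta>'"
      using floor_divide_lower[OF assms(1)] floor_divide_upper[OF assms(1)]
      by (auto intro: less_imp_le)
    then have "(?c, ?r) \<in> touched \<delta>' A" using z by (auto simp: touched_def)
    moreover have "c \<in> ?S ?c" "r \<in> ?S ?r" using * z by (auto simp: strip_def)
    ultimately show "b \<in> (\<Union>(c, r)\<in>touched \<delta>' A. ?S c \<times> ?S r)" unfolding b by blast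
  qed
  have fin2: "finite (\<Union>(c, r)\<in>touched \<delta>' A. ?S c \<times> ?S r)"
    using fin S by auto
  show "finite (touched \<delta> A)" using finite_subset[OF sub fin2] .
  have "card (touched \<delta> A) \<le> card (\<Union>(c, r)\<in>touched \<delta>' A. ?S c \<times> ?S r)"
    using card_mono[OF fin2 sub] .
  also have "\<dots> \<le> (\<Sum>b\<in>touched \<delta>' A. card (case b of (c, r) \<Rightarrow> ?S c \<times> ?S r))"
    by (rule card_UN_le[OF fin])
  also have "\<dots> \<le> (\<Sum>b\<in>touched \<delta>' A. 9)"
  proof (rule sum_mono)
    fix b :: "int \<times> int"
    have "card (?S c) * card (?S r) \<le> 3 * 3" for c r
      using S by (intro mult_le_mono) auto
    then show "card (case b of (c, r) \<Rightarrow> ?S c \<times> ?S r) \<le> 9"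
      by (auto simp: card_cartesian_product split: prod.split)
  qed
  finally show "card (touched \<delta> A) \<le> 9 * card (touched \<delta>' A)" by simp
qed

section \<open>Words and positional numerals\<close>

text \<open>A word of digits addresses a cell of the grid: its first coordinates, read as a base-\<open>n\<close> numeral,
give the column, and its second coordinates, read in base \<open>m\<close>, give the row. Distinct words of the
same length thus have distinct cells.\<close>

definition words :: "'a set \<Rightarrow> nat \<Rightarrow> 'a list set" where
  "words A k = {w. set w \<subseteq> A \<and> length w = k}"

lemma finite_words: "finite A \<Longrightarrow> finite (words A k)"
  and card_words: "finite A \<Longrightarrow> card (words A k) = card A ^ k"
  unfolding words_def by (simp_all add: finite_lists_length_eq card_lists_length_eq)

lemma words_0 [simp]: "words A 0 = {[]}"
  by (auto simp: words_def)

primrec place_value :: "nat \<Rightarrow> nat list \<Rightarrow> nat" where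
  "place_value b [] = 0"
| "place_value b (x # xs) = x * b ^ length xs + place_value b xs"

lemma place_value_append:
  "place_value b (xs @ ys) = place_value b xs * b ^ length ys + place_value b ys"
  by (induction xs) (auto simp: algebra_simps power_add)

lemma place_value_less:
  assumes "set xs \<subseteq> {..<b}"
  shows "place_value b xs < b ^ length xs"
  using assms
proof (induction xs)
  case (Cons x xs)
  then have "x + 1 \<le> b" "place_value b xs < b ^ length xs" by auto
  then have "x * b ^ length xs + place_value b xs < (x + 1) * b ^ length xs" by simp
  also have "\<dots> \<le> b * b ^ length xs" using \<open>x + 1 \<le> b\<close> by (rule mult_le_mono1)
  finally show ?case by simp
qed simp

lemma place_value_inj:
  assumes "set xs \<subseteq> {..<b}" "set ys \<subseteq> {..<b}" "length xs = length ys"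
    and "place_value b xs = place_value b ys"
  shows "xs = ys"
  using assms(3,1,2,4)
proof (induction xs ys rule: list_induct2)
  case (Cons x xs y ys)
  let ?B = "b ^ length xs"
  have lt: "place_value b xs < ?B" "place_value b ys < ?B"
    using place_value_less[of xs b] place_value_less[of ys b] Cons by auto
  have eq: "x * ?B + place_value b xs = y * ?B + place_value b ys"
    using Cons by simp
  have B: "?B \<noteq> 0" using lt by linarith
  have "x = (x * ?B + place_value b xs) div ?B" using lt by (simp add: div_mult_self3[OF B])
  also have "\<dots> = y" using lt unfolding eq by (simp add: div_mult_self3[OF B])
  finally have "x = y" .
  then show ?case using eq Cons by simp
qed simp

lemma place_value_replicate_0 [simp]: "place_value b (replicate k 0) = 0"
  by (induction k) auto

lemma place_value_replicate_max:
  "b > 0 \<Longrightarrow> place_value b (replicate k (b - 1)) + 1 = b ^ k"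
  by (cases b; induction k) (auto simp: algebra_simps)

lemma place_value_eq_0:
  assumes "set xs \<subseteq> {..<b}" "place_value b xs = 0"
  shows "xs = replicate (length xs) 0"
proof (cases "xs = []")
  case False
  then have "0 < b" using assms(1) by (cases xs) auto
  then show ?thesis using assms by (intro place_value_inj[of _ b]) auto
qed simp

lemma place_value_eq_max:
  assumes "set xs \<subseteq> {..<b}" "place_value b xs + 1 = b ^ length xs"
  shows "xs = replicate (length xs) (b - 1)"
proof (cases "xs = []")
  case False
  then have "0 < b" using assms(1) by (cases xs) auto
  then show ?thesis
    using assms place_value_replicate_max[of b "length xs"]
    by (intro place_value_inj[of _ b]) auto
qed simp

text \<open>A point of a cell can lie on an outer edge of the unit interval only if all digits of the cell are
extreme. For the points of the carpet that a basic rectangle shares with its neighbours this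
determines one coordinate of every later digit.\<close>

lemma numeral_point_bounds:
  fixes x :: real
  assumes "0 \<le> x" "x \<le> 1" "set xs \<subseteq> {..<b}"
  defines "\<xi> \<equiv> (x + place_value b xs) / real b ^ length xs"
  shows "0 \<le> \<xi>" "\<xi> \<le> 1"
    "\<xi> = 0 \<Longrightarrow> xs = replicate (length xs) 0"
    "\<xi> = 1 \<Longrightarrow> xs = replicate (length xs) (b - 1)"
proof -
  have lt: "place_value b xs + 1 \<le> b ^ length xs" using place_value_less[OF assms(3)] by simp
  then have lt': "real (place_value b xs) + 1 \<le> real b ^ length xs"
    by (metis of_nat_1 of_nat_add of_nat_le_iff of_nat_power)
  have pos: "real b ^ length xs > 0" using lt' by linarith
  show "0 \<le> \<xi>" using assms by simp
  show "\<xi> \<le> 1" using pos lt' assms(2) by (simp add: \<xi>_def)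
  { assume "\<xi> = 0"
    then have "x + place_value b xs = 0" using pos unfolding \<xi>_def by (metis divide_eq_0_iff less_irrefl)
    then have "place_value b xs = 0" using assms(1) by linarith
    then show "xs = replicate (length xs) 0" using place_value_eq_0 assms(3) by blast }
  { assume "\<xi> = 1"
    then have "x + place_value b xs = real b ^ length xs" using pos unfolding \<xi>_def by simp
    then have "real (place_value b xs + 1) = real (b ^ length xs)" using lt' assms(2) by simp
    then have "place_value b xs + 1 = b ^ length xs" using of_nat_eq_iff by blast
    then show "xs = replicate (length xs) (b - 1)" using place_value_eq_max assms(3) by blast }
qed

lemma neighbouring_cells:
  fixes \<xi> B :: real and I I' :: nat
  assumes "0 \<le> \<xi>" "\<xi> \<le> 1" "B > 0"
    and "real I / B \<le> (\<xi> + I') / B" "(\<xi> + I') / B \<le> (real I + 1) / B"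
  shows "I' = I \<or> (I' = I + 1 \<and> \<xi> = 0) \<or> (I' + 1 = I \<and> \<xi> = 1)"
proof -
  have *: "real I \<le> \<xi> + I'" "\<xi> + I' \<le> real I + 1"
    using assms by (simp_all add: divide_le_cancel)
  then have "I \<le> I' + 1" "I' \<le> I + 1" using assms by linarith+
  then consider "I' = I" | "I' = I + 1" | "I' + 1 = I" by linarith
  then show ?thesis using * assms by cases auto
qed

section \<open>The carpet and its words\<close>

locale carpet =
  fixes n m :: nat and D :: "(nat \<times> nat) set" and E :: "(real \<times> real) set"
  assumes m_ge_2: "2 \<le> m" and m_less_n: "m < n"
    and digits: "carpet_digits n m D" and carpet: "is_carpet n m D E"
begin

abbreviation "unit_square \<equiv> {0..1::real} \<times> {0..1::real}"
abbreviation "used_rows \<equiv> snd ` D"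
abbreviation "word_map \<equiv> carpet_word_map n m"
abbreviation "column_index w \<equiv> place_value n (map fst w)"
abbreviation "row_index w \<equiv> place_value m (map snd w)"

lemma n_ge_3: "3 \<le> n" using m_ge_2 m_less_n by linarith
lemma D_ne: "D \<noteq> {}" and D_sub: "D \<subseteq> {0..<n} \<times> {0..<m}"
  using digits by (auto simp: carpet_digits_def)
lemma finite_D [simp]: "finite D"
  using D_sub by (rule finite_subset) auto
lemma card_D_pos: "card D > 0" using D_ne by (simp add: card_gt_0_iff)
lemma card_used_rows_pos: "card used_rows > 0" using D_ne by (simp add: card_gt_0_iff)
lemma fst_less: "d \<in> D \<Longrightarrow> fst d < n" and snd_less: "d \<in> D \<Longrightarrow> snd d < m"
  using D_sub by auto
lemma used_rows_sub: "used_rows \<subseteq> {..<m}" using snd_less by auto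

lemma E_ne: "E \<noteq> {}" and E_compact: "compact E"
  and E_eq: "E = (\<Union>d\<in>D. carpet_map n m d ` E)"
  using carpet unfolding is_carpet_def by blast+

lemma word_map_Nil [simp]: "word_map [] = id"
  and word_map_Cons: "word_map (d # w) = carpet_map n m d \<circ> word_map w"
  by (simp_all add: carpet_word_map_def)

lemma word_map_append: "word_map (v @ w) = word_map v \<circ> word_map w"
  by (induction v) (simp_all add: word_map_Cons comp_assoc)

lemma word_map_eq:
  "word_map w z = ((fst z + column_index w) / real n ^ length w,
                   (snd z + row_index w) / real m ^ length w)"
proof (induction w)
  case (Cons d w)
  have "real n > 0" "real m > 0" using n_ge_3 m_ge_2 by auto
  then show ?case by (simp add: word_map_Cons Cons.IH carpet_map_def field_simps)
qed (cases z; simp)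

lemma map_fst_digits: "w \<in> words D k \<Longrightarrow> set (map fst w) \<subseteq> {..<n}"
  and map_snd_digits: "w \<in> words D k \<Longrightarrow> set (map snd w) \<subseteq> {..<m}"
  using fst_less snd_less by (auto simp: words_def)

lemma map_snd_words: "w \<in> words D k \<Longrightarrow> map snd w \<in> words used_rows k"
  by (auto simp: words_def)

lemma E_word_image:
  assumes "w \<in> words D k" "z \<in> E"
  shows "word_map w z \<in> E"
proof -
  have "set w \<subseteq> D" using assms(1) by (simp add: words_def)
  then show ?thesis
  proof (induction w)
    case (Cons d w)
    then have "word_map w z \<in> E" "d \<in> D" by auto
    then have "carpet_map n m d (word_map w z) \<in> E" using E_eq by blast
    then show ?case by (simp add: word_map_Cons)
  qed (use assms in simp)
qed

lemma E_word_decomposition: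
  assumes "z \<in> E"
  obtains w z' where "w \<in> words D k" "z' \<in> E" "z = word_map w z'"
proof -
  have "\<exists>w\<in>words D k. \<exists>z'\<in>E. z = word_map w z'" using assms
  proof (induction k arbitrary: z)
    case (Suc k)
    from Suc.prems obtain d z1 where d: "d \<in> D" "z1 \<in> E" "z = carpet_map n m d z1"
      using E_eq by blast
    from Suc.IH[OF d(2)] obtain w z' where "w \<in> words D k" "z' \<in> E" "z1 = word_map w z'" by blast
    then have "d # w \<in> words D (Suc k)" "z = word_map (d # w) z'"
      using d by (auto simp: words_def word_map_Cons)
    with \<open>z' \<in> E\<close> show ?case by blast
  qed simp
  then show thesis using that by blast
qed

text \<open>A coordinate that every map of the system contracts as \<open>(f + g)/b\<close> attains its extrema on \<open>E\<close>, and
an extremal point is itself the image of a point of \<open>E\<close>; comparing the two values gives the fixed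
points \<open>lo/(b - 1)\<close> and \<open>hi/(b - 1)\<close> as bounds. The case of equal bounds is used as well: it
shows that a carpet with a single used row lies on a horizontal line.\<close>

lemma self_similar_bounds:
  fixes f :: "real \<times> real \<Rightarrow> real" and b :: nat and lo hi :: real
  assumes cont: "continuous_on E f" and b: "2 \<le> b"
    and step: "\<And>d z. d \<in> D \<Longrightarrow> f (carpet_map n m d z) = (f z + g d) / b"
    and g: "\<And>d. d \<in> D \<Longrightarrow> lo \<le> g d \<and> g d \<le> hi"
    and z: "z \<in> E"
  shows "lo / (real b - 1) \<le> f z" "f z \<le> hi / (real b - 1)"
proof -
  have b': "real b - 1 > 0" using b by simp
  obtain u where u: "u \<in> E" "\<And>y. y \<in> E \<Longrightarrow> f y \<le> f u"
    using continuous_attains_sup[OF E_compact E_ne cont] by blast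
  obtain l where l: "l \<in> E" "\<And>y. y \<in> E \<Longrightarrow> f l \<le> f y"
    using continuous_attains_inf[OF E_compact E_ne cont] by blast
  obtain d u' where "d \<in> D" "u' \<in> E" "u = carpet_map n m d u'" using u(1) E_eq by blast
  then have "f u * b = f u' + g d" "g d \<le> hi" "f u' \<le> f u"
    using step g u b by (auto simp: field_simps)
  then have "f u \<le> hi / (real b - 1)" using b' by (simp add: field_simps)
  then show "f z \<le> hi / (real b - 1)" using u(2)[OF z] by linarith
  obtain d l' where "d \<in> D" "l' \<in> E" "l = carpet_map n m d l'" using l(1) E_eq by blast
  then have "f l * b = f l' + g d" "lo \<le> g d" "f l \<le> f l'"
    using step g l b by (auto simp: field_simps)
  then have "lo / (real b - 1) \<le> f l" using b' by (simp add: field_simps)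
  then show "lo / (real b - 1) \<le> f z" using l(2)[OF z] by linarith
qed

lemma fst_bounds:
  assumes "z \<in> E" and "\<And>d. d \<in> D \<Longrightarrow> lo \<le> real (fst d) \<and> real (fst d) \<le> hi"
  shows "lo / (real n - 1) \<le> fst z" "fst z \<le> hi / (real n - 1)"
proof -
  have st: "fst (carpet_map n m d z) = (fst z + real (fst d)) / real n" for d z
    by (simp add: carpet_map_def)
  show "lo / (real n - 1) \<le> fst z" "fst z \<le> hi / (real n - 1)"
    using self_similar_bounds[of fst n "\<lambda>d. real (fst d)" lo hi z, 
        OF continuous_on_fst[OF continuous_on_id] _ st assms(2) assms(1)] n_ge_3
    by auto
qed

lemma snd_bounds:
  assumes "z \<in> E" and "\<And>d. d \<in> D \<Longrightarrow> lo \<le> real (snd d) \<and> real (snd d) \<le> hi"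
  shows "lo / (real m - 1) \<le> snd z" "snd z \<le> hi / (real m - 1)"
proof -
  have st: "snd (carpet_map n m d z) = (snd z + real (snd d)) / real m" for d z
    by (simp add: carpet_map_def)
  show "lo / (real m - 1) \<le> snd z" "snd z \<le> hi / (real m - 1)"
    using self_similar_bounds[of snd m "\<lambda>d. real (snd d)" lo hi z, 
        OF continuous_on_snd[OF continuous_on_id] _ st assms(2) assms(1)] m_ge_2
    by auto
qed

lemma E_in_square: 
  assumes "z \<in> E"
  shows "0 \<le> fst z" "fst z \<le> 1" "0 \<le> snd z" "snd z \<le> 1"
proof -
  have "0 \<le> real (fst d) \<and> real (fst d) \<le> real n - 1" if "d \<in> D" for d
    using fst_less[OF that] by linarith
  from fst_bounds[OF assms this] show "0 \<le> fst z" "fst z \<le> 1" using n_ge_3 by auto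
  have "0 \<le> real (snd d) \<and> real (snd d) \<le> real m - 1" if "d \<in> D" for d
    using snd_less[OF that] by linarith
  from snd_bounds[OF assms this] show "0 \<le> snd z" "snd z \<le> 1" using m_ge_2 by auto
qed

section \<open>The measure of a basic rectangle\<close>

lemma carpet_map_continuous: "continuous_on A (carpet_map n m d)"
  unfolding carpet_map_def[abs_def] using m_ge_2 n_ge_3 by (intro continuous_intros) auto

lemma carpet_map_inj: "inj (carpet_map n m d)"
  using m_ge_2 n_ge_3 by (auto intro!: injI simp: carpet_map_def prod_eq_iff)

lemma word_map_square_compact: "compact (word_map w ` unit_square)"
proof (induction w)
  case (Cons d w)
  then show ?case
    using compact_continuous_image[OF carpet_map_continuous]
    unfolding word_map_Cons image_comp[symmetric] by blast
qed (simp add: compact_Times)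

context
  fixes \<mu> :: "(real \<times> real) measure"
  assumes bern: "uniform_bernoulli_measure n m D E \<mu>"
begin

lemma prob_mu: "prob_space \<mu>" and sets_mu: "sets \<mu> = sets borel"
  and mu_E: "measure \<mu> E = 1"
  and mu_eq: "A \<in> sets borel \<Longrightarrow>
    measure \<mu> A = (\<Sum>d\<in>D. 1 / real (card D) * measure \<mu> (carpet_map n m d -` A))"
  using bern unfolding uniform_bernoulli_measure_def by blast+

interpretation prob_space \<mu> by (rule prob_mu)

lemma E_sets: "E \<in> sets \<mu>"
  using E_compact by (simp add: sets_mu compact_imp_closed)

lemma measure_disjoint_E:
  assumes "A \<in> sets \<mu>" "A \<inter> E = {}"
  shows "measure \<mu> A = 0"
proof -
  have "measure \<mu> (A \<union> E) = measure \<mu> A + measure \<mu> E"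
    using assms E_sets by (intro finite_measure_Union) auto
  moreover have "measure \<mu> (A \<union> E) \<le> 1" by (rule prob_le_1)
  ultimately show ?thesis using mu_E measure_nonneg[of \<mu> A] by linarith
qed

text \<open>Let \<open>V\<close> be an edge line of the square. A map of the system pulls \<open>V\<close> back to \<open>V\<close> itself if
its digit is extreme on that side, and to a line missing the carpet otherwise. Hence
\<open>\<mu>(V) = (c/N) \<mu>(V)\<close>, where \<open>c\<close> counts the extreme digits, and \<open>c < N\<close> as soon as two digits
differ in this coordinate.\<close>

lemma edge_null:
  fixes f :: "real \<times> real \<Rightarrow> real" and b :: nat and e :: real
  assumes cont: "continuous_on UNIV f" and b: "2 \<le> b"
    and step: "\<And>d z. d \<in> D \<Longrightarrow> f (carpet_map n m d z) = (f z + real (g d)) / b"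
    and g: "\<And>d. d \<in> D \<Longrightarrow> g d < b"
    and fE: "\<And>z. z \<in> E \<Longrightarrow> 0 \<le> f z \<and> f z \<le> 1"
    and d12: "d1 \<in> D" "d2 \<in> D" "g d1 \<noteq> g d2" and e: "e = 0 \<or> e = 1"
  shows "{z. f z = e} \<in> sets \<mu>" "measure \<mu> {z. f z = e} = 0"
proof -
  let ?V = "\<lambda>x. {z. f z = x}"
  have V: "?V x \<in> sets borel" for x
    using closed_Collect_eq[OF cont, of "\<lambda>_. x"] by simp
  then show "?V e \<in> sets \<mu>" by (simp add: sets_mu)
  let ?h = "\<lambda>d. real b * e - real (g d)"
  let ?G = "{d\<in>D. ?h d = e}"
  have pre: "carpet_map n m d -` ?V e = ?V (?h d)" if "d \<in> D" for d
    using b unfolding vimage_def by (auto simp: step[OF that] divide_eq_eq algebra_simps)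
  have null: "measure \<mu> (?V (?h d)) = 0" if "d \<in> D" "?h d \<noteq> e" for d
  proof (rule measure_disjoint_E)
    have "g d + 1 \<le> b" using g[OF that(1)] by simp
    then have "real (g d) + 1 \<le> real b" by linarith
    then have "?h d < 0 \<or> ?h d > 1" using e that(2) by auto
    then show "?V (?h d) \<inter> E = {}" using fE by fastforce
  qed (simp add: V sets_mu)
  have "measure \<mu> (?V e) = (\<Sum>d\<in>D. if ?h d = e then measure \<mu> (?V e) / card D else 0)"
  proof (subst mu_eq[OF V], intro sum.cong refl)
    fix d assume d: "d \<in> D"
    show "1 / real (card D) * measure \<mu> (carpet_map n m d -` ?V e)
        = (if ?h d = e then measure \<mu> (?V e) / card D else 0)"
      unfolding pre[OF d] using null[OF d] by simp
  qed
  also have "\<dots> = real (card ?G) * (measure \<mu> (?V e) / card D)"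
    by (simp add: sum.If_cases Int_def)
  finally have "measure \<mu> (?V e) = real (card ?G) * (measure \<mu> (?V e) / card D)" .
  then have "measure \<mu> (?V e) * card D = real (card ?G) * (measure \<mu> (?V e) / card D) * card D"
    by (rule arg_cong)
  then have eq: "measure \<mu> (?V e) * card D = card ?G * measure \<mu> (?V e)"
    using card_D_pos by simp
  have "\<not> (d1 \<in> ?G \<and> d2 \<in> ?G)" using d12(3) by auto
  then have "?G \<subset> D" using d12(1,2) by blast
  then have "card ?G < card D" by (intro psubset_card_mono) auto
  then show "measure \<mu> (?V e) = 0" using eq by auto
qed

text \<open>Pulled back by the map of \<open>d'\<close>, the rectangle of another digit \<open>d\<close> becomes a unit square with a
different integer corner. It meets the carpet at most in an edge line, and a line of
that direction is null since \<open>d\<close> and \<open>d'\<close> differ in the matching coordinate.\<close>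

lemma neighbour_null:
  assumes d: "d \<in> D" "d' \<in> D" "d \<noteq> d'"
  shows "measure \<mu> (carpet_map n m d' -` carpet_map n m d ` unit_square) = 0"
proof -
  let ?A = "carpet_map n m d' -` carpet_map n m d ` unit_square"
  have null: "measure \<mu> ?A = 0"
    if sub: "?A \<inter> E \<subseteq> {z. f z = 0} \<union> {z. f z = 1}"
      and V: "{z. f z = 0} \<in> sets \<mu>" "measure \<mu> {z. f z = 0} = 0"
             "{z. f z = 1} \<in> sets \<mu>" "measure \<mu> {z. f z = 1} = 0"
    for f :: "real \<times> real \<Rightarrow> real"
  proof -
    let ?V = "{z. f z = 0} \<union> {z. f z = 1}"
    have "measure \<mu> ?A \<le> measure \<mu> (?V \<union> - E)"
    proof (rule finite_measure_mono)
      show "?V \<union> - E \<in> sets \<mu>" using V E_sets by (auto simp: sets_mu)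
    qed (use sub in blast)
    also have "\<dots> \<le> measure \<mu> ?V + measure \<mu> (- E)"
      using V E_sets by (intro measure_Un_le) (auto simp: sets_mu)
    also have "measure \<mu> ?V \<le> measure \<mu> {z. f z = 0} + measure \<mu> {z. f z = 1}"
      using V by (intro measure_Un_le)
    also have "measure \<mu> (- E) = 0" using E_sets by (intro measure_disjoint_E) (auto simp: sets_mu)
    finally show ?thesis using V measure_nonneg[of \<mu> ?A] by linarith
  qed
  have A: "\<exists>y. 0 \<le> fst y \<and> fst y \<le> 1 \<and> 0 \<le> snd y \<and> snd y \<le> 1 \<and>
      fst z + real (fst d') = fst y + real (fst d) \<and>
      snd z + real (snd d') = snd y + real (snd d)" if z: "z \<in> ?A" for z
  proof -
    have "carpet_map n m d' z \<in> carpet_map n m d ` unit_square" using z by (rule vimageD)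
    then obtain y where "carpet_map n m d' z = carpet_map n m d y" "y \<in> unit_square" by (rule imageE)
    then show ?thesis using m_ge_2 n_ge_3 by (intro exI[of _ y]) (auto simp: carpet_map_def)
  qed
  show ?thesis
  proof (cases "fst d = fst d'")
    case False
    have "?A \<inter> E \<subseteq> {z. fst z = 0} \<union> {z. fst z = 1}"
    proof
      fix z assume z: "z \<in> ?A \<inter> E"
      have "real (fst d) + 1 \<le> real (fst d') \<or> real (fst d') + 1 \<le> real (fst d)"
        using False by linarith
      then have "fst z = 0 \<or> fst z = 1"
        using A[of z] E_in_square[of z] z by auto
      then show "z \<in> {z. fst z = 0} \<union> {z. fst z = 1}" by auto
    qed
    then show ?thesis
      using d False n_ge_3 E_in_square fst_less
      by (intro null[of fst] edge_null[where g = fst and b = n and ?d1.0 = d and ?d2.0 = d'])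
         (auto intro!: continuous_intros simp: carpet_map_def)
  next
    case True
    then have False: "snd d \<noteq> snd d'" using d by (auto simp: prod_eq_iff)
    have "?A \<inter> E \<subseteq> {z. snd z = 0} \<union> {z. snd z = 1}"
    proof
      fix z assume z: "z \<in> ?A \<inter> E"
      have "real (snd d) + 1 \<le> real (snd d') \<or> real (snd d') + 1 \<le> real (snd d)"
        using False by linarith
      then have "snd z = 0 \<or> snd z = 1"
        using A[of z] E_in_square[of z] z by auto
      then show "z \<in> {z. snd z = 0} \<union> {z. snd z = 1}" by auto
    qed
    then show ?thesis
      using d False m_ge_2 E_in_square snd_less
      by (intro null[of snd] edge_null[where g = snd and b = m and ?d1.0 = d and ?d2.0 = d'])
         (auto intro!: continuous_intros simp: carpet_map_def)
  qed
qed

lemma word_map_square_sub: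
  assumes "set w \<subseteq> D"
  shows "word_map w ` unit_square \<subseteq> unit_square"
proof -
  have w: "w \<in> words D (length w)" using assms by (simp add: words_def)
  show ?thesis
    using numeral_point_bounds(1,2)[OF _ _ map_fst_digits[OF w]]
      numeral_point_bounds(1,2)[OF _ _ map_snd_digits[OF w]]
    by (auto simp: word_map_eq)
qed

text \<open>Closed basic rectangles may share edges, so the value \<open>N\<^sup>-\<^sup>k\<close> depends on these edges being null: in the
self-similarity equation only the term of the first digit of the word survives.\<close>

lemma measure_basic_rectangle:
  assumes "set w \<subseteq> D"
  shows "measure \<mu> (word_map w ` unit_square) = 1 / real (card D) ^ length w"
  using assms
proof (induction w)
  case Nil
  have "measure \<mu> E \<le> measure \<mu> unit_square"
    using E_in_square
    by (intro finite_measure_mono)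
       (auto simp: sets_mu intro!: borel_closed closed_Times)
  then have "1 \<le> measure \<mu> unit_square" by (simp add: mu_E)
  then show ?case using prob_le_1[of unit_square] by simp
next
  case (Cons d w)
  let ?R = "word_map w ` unit_square"
  have img: "word_map (d # w) ` unit_square = carpet_map n m d ` ?R"
    by (simp add: word_map_Cons image_comp)
  have meas: "carpet_map n m d ` ?R \<in> sets borel"
    using word_map_square_compact[of "d # w"] by (simp add: img borel_compact)
  have zero: "measure \<mu> (carpet_map n m d' -` carpet_map n m d ` ?R) = 0"
    if d': "d' \<in> D" "d' \<noteq> d" for d'
  proof -
    have "closed (carpet_map n m d ` unit_square)"
      by (intro compact_imp_closed compact_continuous_image carpet_map_continuous compact_Times) auto
    then have "closed (carpet_map n m d' -` carpet_map n m d ` unit_square)"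
      by (intro closed_vimage carpet_map_continuous)
    then have "measure \<mu> (carpet_map n m d' -` carpet_map n m d ` ?R)
        \<le> measure \<mu> (carpet_map n m d' -` carpet_map n m d ` unit_square)"
      using word_map_square_sub[of w] Cons.prems
      by (intro finite_measure_mono vimage_mono image_mono) (auto simp: sets_mu)
    also have "\<dots> = 0" using neighbour_null[of d d'] d' Cons.prems by auto
    finally show ?thesis using measure_nonneg[of \<mu>] by (simp add: measure_le_0_iff)
  qed
  have "measure \<mu> (carpet_map n m d ` ?R)
      = (\<Sum>d'\<in>D. if d' = d then 1 / real (card D) * measure \<mu> ?R else 0)"
    unfolding mu_eq[OF meas]
    by (intro sum.cong refl) (auto simp: zero inj_vimage_image_eq[OF carpet_map_inj])
  also have "\<dots> = 1 / real (card D) * measure \<mu> ?R" using Cons.prems by simp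
  finally show ?case using Cons by (simp add: img)
qed

end

end

section \<open>Counting mesh boxes through approximate squares\<close>

lemma card_le_fibres:
  assumes "finite S" "finite T" "F ` S \<subseteq> T" "\<And>b. b \<in> T \<Longrightarrow> card {x\<in>S. F x = b} \<le> k"
  shows "card S \<le> k * card T"
proof -
  have "card S = (\<Sum>b\<in>T. card {x\<in>S. F x = b})"
    using sum.group[OF assms(1-3), of "\<lambda>_. 1::nat"] by simp
  also have "\<dots> \<le> (\<Sum>b\<in>T. k)" using assms(4) by (rule sum_mono)
  finally show ?thesis by (simp add: mult.commute)
qed

lemma map_eq_replicateD: "map f u = replicate p x \<Longrightarrow> d \<in> set u \<Longrightarrow> f d = x"
  by (metis image_eqI in_set_replicate list.set_map)

context carpet
begin

text \<open>Write \<open>q = k + p\<close>. An approximate square is a cell of width \<open>n\<^sup>-\<^sup>q\<close> and height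
\<open>m\<^sup>-\<^sup>(\<^sup>q\<^sup>+\<^sup>l\<^sup>)\<close> that meets the carpet; it is given by \<open>q\<close> digits followed by \<open>l\<close> used rows. Inside the basic
rectangle of a word of length \<open>k\<close> there remain \<open>p\<close> free digits and \<open>l\<close> free rows. These are grouped
by the sequence \<open>v\<close> of the rows of the \<open>p\<close> digits, and \<open>fibre v\<close> is the group of \<open>v\<close>.\<close>

definition fibre :: "nat list \<Rightarrow> (nat \<times> nat) list set" where
  "fibre v = {u \<in> words D (length v). map snd u = v}"

lemma finite_fibre [simp]: "finite (fibre v)"
  unfolding fibre_def by (simp add: finite_words)

lemma fibre_nonempty: "v \<in> words used_rows p \<Longrightarrow> fibre v \<noteq> {}"
proof (induction v arbitrary: p)
  case (Cons j v)
  then have "v \<in> words used_rows (length v)" "j \<in> used_rows" by (auto simp: words_def)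
  then obtain u i where "u \<in> fibre v" "(i, j) \<in> D" using Cons.IH by fastforce
  then have "(i, j) # u \<in> fibre (j # v)" by (auto simp: fibre_def words_def)
  then show ?case by blast
qed (simp add: fibre_def)

lemma card_fibre_pos: "v \<in> words used_rows p \<Longrightarrow> 1 \<le> card (fibre v)"
  using fibre_nonempty[of v p] by (simp add: Suc_le_eq card_gt_0_iff)

lemma sum_card_fibre: "(\<Sum>v\<in>words used_rows p. card (fibre v)) = card D ^ p"
proof -
  have "card D ^ p = (\<Sum>v\<in>words used_rows p. card {u\<in>words D p. map snd u = v})"
    using sum.group[of "words D p" "words used_rows p" "map snd" "\<lambda>_. 1::nat"]
    by (simp add: finite_words card_words image_subset_iff map_snd_words)
  also have "\<dots> = (\<Sum>v\<in>words used_rows p. card (fibre v))"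
    by (intro sum.cong refl) (auto simp: fibre_def words_def)
  finally show ?thesis by simp
qed

text \<open>The mesh columns, counted from the left edge of the basic rectangle, that can be touched at the height
given by \<open>v\<close>. The columns of width \<open>\<delta>\<close> in the rectangle are mesh columns, and an own approximate
square touches its column and the two adjacent ones. A point of the left neighbour lies on the left
edge, hence touches the columns \<open>-1\<close> and \<open>0\<close>, and all its digits have first coordinate \<open>n - 1\<close>;
symmetrically for the right neighbour.\<close>

definition near_columns :: "nat list \<Rightarrow> int set" where
  "near_columns v =
     (\<Union>u\<in>fibre v. {int (column_index u) - 1 .. int (column_index u) + 1})
     \<union> (if \<forall>j\<in>set v. (n - 1, j) \<in> D then {-1, 0} else {})
     \<union> (if \<forall>j\<in>set v. (0, j) \<in> D then {int (n ^ length v) - 1, int (n ^ length v)} else {})"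

lemma finite_near_columns [simp]: "finite (near_columns v)"
  by (simp add: near_columns_def)

text \<open>The contributions of the two lateral neighbours do not add up. If both occur, then the rows of \<open>v\<close>
carry digits in the first and in the last column alike, so that the rectangle has own approximate
squares at both ends, and their adjacent columns already include everything that the neighbours touch.\<close>

lemma card_near_columns: "card (near_columns v) \<le> 3 * card (fibre v) + 2"
proof -
  let ?U = "\<Union>u\<in>fibre v. {int (column_index u) - 1 .. int (column_index u) + 1}"
  let ?P = "\<forall>j\<in>set v. (n - 1, j) \<in> D" and ?Q = "\<forall>j\<in>set v. (0, j) \<in> D"
  have fin: "finite ?U" by simp
  have "card ?U \<le> (\<Sum>u\<in>fibre v. card {int (column_index u) - 1 .. int (column_index u) + 1})"
    by (rule card_UN_le) simp
  then have U: "card ?U \<le> 3 * card (fibre v)" by simp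
  have 1: "0 \<in> ?U" "-1 \<in> ?U" if ?Q
  proof -
    let ?u = "map (Pair 0) v"
    have u: "?u \<in> fibre v" using that by (auto simp: fibre_def words_def comp_def)
    have "column_index ?u = 0" by (simp add: comp_def map_replicate_const)
    then show "0 \<in> ?U" "-1 \<in> ?U" by (auto intro!: bexI[OF _ u])
  qed
  have 2: "int (n ^ length v) \<in> ?U" "int (n ^ length v) - 1 \<in> ?U" if ?P
  proof -
    let ?u = "map (Pair (n - 1)) v"
    have u: "?u \<in> fibre v" using that by (auto simp: fibre_def words_def comp_def)
    have "column_index ?u + 1 = n ^ length v"
      using n_ge_3 place_value_replicate_max[of n "length v"]
      by (simp add: comp_def map_replicate_const)
    then have *: "int (n ^ length v) = int (column_index ?u) + 1" by linarith
    show "int (n ^ length v) \<in> ?U" "int (n ^ length v) - 1 \<in> ?U"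
      unfolding * by (auto intro!: bexI[OF _ u])
  qed
  show ?thesis
  proof (cases "?P \<and> ?Q")
    case True
    then have "near_columns v = ?U" using 1 2 unfolding near_columns_def by auto
    then show ?thesis using U by simp
  next
    case False
    then have "near_columns v \<subseteq> ?U \<union> {-1, 0} \<or>
        near_columns v \<subseteq> ?U \<union> {int (n ^ length v) - 1, int (n ^ length v)}"
    proof (cases ?P)
      case True
      with False have "\<not> ?Q" by blast
      then have "near_columns v = ?U \<union> {-1, 0} \<union> {}"
        unfolding near_columns_def if_P[OF True] by (simp only: if_False)
      then show ?thesis by blast
    next
      case False
      have "A \<union> {} \<union> (if c then B else {}) \<subseteq> A \<union> B" for A B :: "int set" and c by auto
      then show ?thesis unfolding near_columns_def if_not_P[OF False] by blast
    qed
    then obtain a b where "near_columns v \<subseteq> ?U \<union> {a, b}"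
      by (elim disjE) (rule that; assumption)+
    then have "card (near_columns v) \<le> card (?U \<union> {a, b})"
      by (intro card_mono) (use fin in auto)
    also have "\<dots> \<le> card ?U + card {a, b}" by (rule card_Un_le)
    also have "\<dots> \<le> card ?U + 2" by (simp add: card_insert_if)
    finally show ?thesis using U by linarith
  qed
qed

lemma card_near_columns_le: "v \<in> words used_rows p \<Longrightarrow> card (near_columns v) \<le> 5 * card (fibre v)"
  using card_near_columns[of v] card_fibre_pos[of v p] by linarith

lemma card_near_columns_Nil: "card (near_columns []) \<le> 3"
proof -
  have "near_columns [] \<subseteq> {-1, 0, 1}" by (auto simp: near_columns_def fibre_def)
  then have "card (near_columns []) \<le> card {-1, 0, 1::int}" by (intro card_mono) auto
  then show ?thesis by simp
qed

text \<open>A point of the carpet in a basic rectangle belongs to the piece of this rectangle or of one of its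
eight neighbours. Its columns are near columns in each case. If the piece lies in the same row of
rectangles, the point is at the height of some \<open>v1 @ v2\<close>; a piece from the row above has it on the
upper edge, whence \<open>v1\<close> consists of zeros, and a piece from the row below has it on the lower edge,
whence \<open>v1\<close> consists of \<open>m - 1\<close>.\<close>

lemma touched_cover:
  assumes w: "w \<in> words D k" and \<delta>: "\<delta> = 1 / real n ^ (k + p)"
    and cr: "(c, r) \<in> touched \<delta> (word_map w ` unit_square \<inter> E)"
  defines "y_top \<equiv> (real (row_index w) + 1) / real m ^ k" and "y_bot \<equiv> real (row_index w) / real m ^ k"
  obtains v1 v2 where "v1 \<in> words used_rows p" "v2 \<in> words used_rows l"
    "c - int (column_index w * n ^ p) \<in> near_columns v1"
    "r \<in> strip \<delta> (real (place_value m (map snd w @ v1 @ v2)) / real m ^ (k + p + l))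
                ((real (place_value m (map snd w @ v1 @ v2)) + 1) / real m ^ (k + p + l))
     \<or> v1 = replicate p 0 \<and> r \<in> strip \<delta> y_top y_top
     \<or> v1 = replicate p (m - 1) \<and> r \<in> strip \<delta> y_bot y_bot"
proof -
  have n0: "real n > 0" "real m > 0" using n_ge_3 m_ge_2 by auto
  obtain z where z: "z \<in> E" "z \<in> word_map w ` unit_square"
    "of_int c * \<delta> \<le> fst z" "fst z \<le> (of_int c + 1) * \<delta>"
    "of_int r * \<delta> \<le> snd z" "snd z \<le> (of_int r + 1) * \<delta>"
    using cr by (auto simp: touched_def)
  obtain a z' where a: "a \<in> words D (k + p + l)" and z': "z' \<in> E" "z = word_map a z'"
    using E_word_decomposition[OF z(1)] by blast
  define a0 u a2 where "a0 = take k a" and "u = take p (drop k a)" and "a2 = drop (k + p) a"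
  have a_eq: "a = a0 @ u @ a2"
    unfolding a0_def u_def a2_def by (metis append_take_drop_id drop_drop add.commute)
  have len: "length a0 = k" "length u = p" "length a2 = l"
    using a by (auto simp: words_def a0_def u_def a2_def)
  have D: "set a0 \<subseteq> D" "set u \<subseteq> D" "set a2 \<subseteq> D" using a unfolding words_def a_eq by auto
  have ws: "a0 \<in> words D k" "u \<in> words D p" "a2 \<in> words D l" "u @ a2 \<in> words D (p + l)"
    using D len by (auto simp: words_def)
  have len_w: "length w = k" using w by (simp add: words_def)
  define y where "y = word_map (u @ a2) z'"
  define x where "x = word_map a2 z'"
  have zy: "z = word_map a0 y" and yx: "y = word_map u x"
    by (simp_all add: z'(2) a_eq word_map_append y_def x_def)
  note sq = E_in_square[OF z'(1)]
  have len_ua: "length (map fst (u @ a2)) = p + l" "length (map snd (u @ a2)) = p + l"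
    by (simp_all add: len)
  have fy: "(fst z' + real (column_index (u @ a2))) / real n ^ length (map fst (u @ a2)) = fst y"
    and sy: "(snd z' + real (row_index (u @ a2))) / real m ^ length (map snd (u @ a2)) = snd y"
    by (simp_all add: y_def word_map_eq del: map_append)
  have y1: "0 \<le> fst y" "fst y \<le> 1"
    "fst y = 0 \<Longrightarrow> map fst (u @ a2) = replicate (p + l) 0"
    "fst y = 1 \<Longrightarrow> map fst (u @ a2) = replicate (p + l) (n - 1)"
    using numeral_point_bounds[OF sq(1,2) map_fst_digits[OF ws(4)], unfolded fy, unfolded len_ua(1)]
    by blast+
  have y2: "0 \<le> snd y" "snd y \<le> 1"
    "snd y = 0 \<Longrightarrow> map snd (u @ a2) = replicate (p + l) 0"
    "snd y = 1 \<Longrightarrow> map snd (u @ a2) = replicate (p + l) (m - 1)"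
    using numeral_point_bounds[OF sq(3,4) map_snd_digits[OF ws(4)], unfolded sy, unfolded len_ua(2)]
    by blast+
  have x1: "0 \<le> fst x" "fst x \<le> 1"
    using numeral_point_bounds(1,2)[OF sq(1,2) map_fst_digits[OF ws(3)]] len
    unfolding x_def word_map_eq by simp_all
  obtain e where e: "e \<in> unit_square" "z = word_map w e" using z(2) by auto
  let ?I = "column_index w" and ?I' = "column_index a0"
  let ?J = "row_index w" and ?J' = "row_index a0"
  have fz: "fst z = (fst y + ?I') / real n ^ k" and sz: "snd z = (snd y + ?J') / real m ^ k"
    unfolding zy word_map_eq by (simp_all add: len)
  have nb1: "?I' = ?I \<or> (?I' = ?I + 1 \<and> fst y = 0) \<or> (?I' + 1 = ?I \<and> fst y = 1)"
  proof (rule neighbouring_cells[OF y1(1,2), of "real n ^ k"])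
    show "real ?I / real n ^ k \<le> (fst y + ?I') / real n ^ k"
      "(fst y + ?I') / real n ^ k \<le> (real ?I + 1) / real n ^ k"
      unfolding fz[symmetric] e(2) word_map_eq using e(1) n0 len_w
      by (auto intro!: divide_right_mono)
  qed (use n0 in simp)
  have nb2: "?J' = ?J \<or> (?J' = ?J + 1 \<and> snd y = 0) \<or> (?J' + 1 = ?J \<and> snd y = 1)"
  proof (rule neighbouring_cells[OF y2(1,2), of "real m ^ k"])
    show "real ?J / real m ^ k \<le> (snd y + ?J') / real m ^ k"
      "(snd y + ?J') / real m ^ k \<le> (real ?J + 1) / real m ^ k"
      unfolding sz[symmetric] e(2) word_map_eq using e(1) n0 len_w
      by (auto intro!: divide_right_mono)
  qed (use n0 in simp)
  define v1 v2 where "v1 = map snd u" and "v2 = map snd a2"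
  have v: "v1 \<in> words used_rows p" "v2 \<in> words used_rows l"
    using map_snd_words ws by (auto simp: v1_def v2_def)
  have lv: "length v1 = p" by (simp add: v1_def len)
  have cz: "of_int c \<le> (fst y + ?I') * real n ^ p" "(fst y + ?I') * real n ^ p \<le> of_int c + 1"
  proof -
    have "\<delta> > 0" using n0 by (simp add: \<delta>)
    moreover have "fst z = (fst y + ?I') * real n ^ p * \<delta>"
      using n0 by (simp add: fz \<delta> power_add)
    ultimately show "of_int c \<le> (fst y + ?I') * real n ^ p"
      "(fst y + ?I') * real n ^ p \<le> of_int c + 1"
      using z(3,4) by (simp_all add: mult_le_cancel_right_pos)
  qed
  have col: "c - int (?I * n ^ p) \<in> near_columns v1"
    using nb1
  proof (elim disjE conjE)
    assume I: "?I' = ?I"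
    have "fst y * real n ^ p = fst x + column_index u"
      unfolding yx word_map_eq using n0 by (simp add: len)
    then have "(fst y + ?I') * real n ^ p = fst x + column_index u + real_of_int (int (?I * n ^ p))"
      by (simp add: I algebra_simps)
    then have "c - int (?I * n ^ p) \<in> {int (column_index u) - 1 .. int (column_index u) + 1}"
      using cz x1 unfolding atLeastAtMost_iff by linarith
    moreover have "u \<in> fibre v1" using ws by (simp add: fibre_def v1_def len)
    ultimately show ?thesis unfolding near_columns_def by blast
  next
    assume I: "?I' = ?I + 1" "fst y = 0"
    then have "map fst u @ map fst a2 = replicate p 0 @ replicate l 0"
      using y1(3) by (simp add: replicate_add)
    then have "map fst u = replicate p 0" using len by (simp add: append_eq_append_conv)
    then have "fst d = 0" if "d \<in> set u" for d using map_eq_replicateD that by metis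
    then have "(0, snd d) \<in> D" if "d \<in> set u" for d using that D(2) by (metis prod.collapse subsetD)
    then have "\<forall>j\<in>set v1. (0, j) \<in> D" by (simp add: v1_def)
    moreover have "real_of_int (int (?I * n ^ p)) + real_of_int (int (n ^ p)) = (fst y + ?I') * real n ^ p"
      using I by (simp add: algebra_simps)
    then have "c - int (?I * n ^ p) \<in> {int (n ^ p) - 1, int (n ^ p)}"
      using cz unfolding insert_iff by linarith
    ultimately show ?thesis unfolding near_columns_def lv by auto
  next
    assume I: "?I' + 1 = ?I" "fst y = 1"
    then have "map fst u @ map fst a2 = replicate p (n - 1) @ replicate l (n - 1)"
      using y1(4) by (simp add: replicate_add)
    then have "map fst u = replicate p (n - 1)" using len by (simp add: append_eq_append_conv)
    then have "fst d = n - 1" if "d \<in> set u" for d using map_eq_replicateD that by metis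
    then have "(n - 1, snd d) \<in> D" if "d \<in> set u" for d using that D(2) by (metis prod.collapse subsetD)
    then have "\<forall>j\<in>set v1. (n - 1, j) \<in> D" by (simp add: v1_def)
    moreover have "real_of_int (int (?I * n ^ p)) = (fst y + ?I') * real n ^ p"
      unfolding I(1)[symmetric] using I(2) by (simp add: algebra_simps)
    then have "c - int (?I * n ^ p) \<in> {-1, 0}"
      using cz unfolding insert_iff by linarith
    ultimately show ?thesis unfolding near_columns_def lv by auto
  qed
  have row: "r \<in> strip \<delta> (real (place_value m (map snd w @ v1 @ v2)) / real m ^ (k + p + l))
                ((real (place_value m (map snd w @ v1 @ v2)) + 1) / real m ^ (k + p + l))
     \<or> v1 = replicate p 0 \<and> r \<in> strip \<delta> y_top y_top
     \<or> v1 = replicate p (m - 1) \<and> r \<in> strip \<delta> y_bot y_bot"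
    using nb2
  proof (elim disjE conjE)
    assume J: "?J' = ?J"
    let ?Y = "place_value m (map snd w @ v1 @ v2)"
    have "row_index a = ?Y"
      by (simp add: a_eq v1_def v2_def place_value_append J)
    then have "snd z = (snd z' + ?Y) / real m ^ (k + p + l)"
      unfolding z'(2) word_map_eq using a by (simp add: words_def)
    then have "real ?Y / real m ^ (k + p + l) \<le> snd z" "snd z \<le> (real ?Y + 1) / real m ^ (k + p + l)"
      using sq n0 by (auto intro!: divide_right_mono)
    then show ?thesis using z by (auto simp: strip_def)
  next
    assume J: "?J' = ?J + 1" "snd y = 0"
    then have "map snd u @ map snd a2 = replicate p 0 @ replicate l 0"
      using y2(3) by (simp add: replicate_add)
    then have "v1 = replicate p 0" using len by (simp add: append_eq_append_conv v1_def)
    moreover have "snd z = y_top" using J by (simp add: sz y_top_def add.commute)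
    ultimately show ?thesis using z by (auto simp: strip_def)
  next
    assume J: "?J' + 1 = ?J" "snd y = 1"
    then have "map snd u @ map snd a2 = replicate p (m - 1) @ replicate l (m - 1)"
      using y2(4) by (simp add: replicate_add)
    then have "v1 = replicate p (m - 1)" using len by (simp add: append_eq_append_conv v1_def)
    moreover have "snd z = y_bot" unfolding sz y_bot_def J(1)[symmetric] using J(2) by simp
    ultimately show ?thesis using z by (auto simp: strip_def)
  qed
  show thesis by (rule that[OF v col row])
qed

text \<open>The number \<open>\<rho>\<close> bounds the mesh rows met by one approximate square. An edge line meets at most two
mesh rows, which explains the factors \<open>2\<close>.\<close>

lemma touched_upper:
  fixes \<rho> :: nat
  assumes w: "w \<in> words D k" and \<delta>: "\<delta> = 1 / real n ^ (k + p)"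
    and \<rho>: "real n ^ (k + p) / real m ^ (k + p + l) + 1 < real \<rho>"
  defines "T \<equiv> touched \<delta> (word_map w ` unit_square \<inter> E)"
    and "edge \<equiv> \<lambda>j. if replicate p j \<in> words used_rows p then card (near_columns (replicate p j)) else 0"
  shows "finite T"
    "card T \<le> \<rho> * card used_rows ^ l * (\<Sum>v\<in>words used_rows p. card (near_columns v))
              + 2 * edge 0 + 2 * edge (m - 1)"
proof -
  have \<delta>0: "\<delta> > 0" using n_ge_3 by (simp add: \<delta>)
  have m0: "real m > 0" using m_ge_2 by simp
  let ?W = "words used_rows p" and ?V = "words used_rows l"
  define S where "S = (\<lambda>v1 v2. strip \<delta> (real (place_value m (map snd w @ v1 @ v2)) / real m ^ (k + p + l))
                ((real (place_value m (map snd w @ v1 @ v2)) + 1) / real m ^ (k + p + l)))"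
  define L where "L = (\<lambda>y::real. strip \<delta> y y)"
  have "((real a + 1) / real m ^ (k + p + l) - real a / real m ^ (k + p + l)) / \<delta> + 1 < real \<rho>" for a
    using \<rho> by (simp add: \<delta> diff_divide_distrib[symmetric])
  from card_strip[OF \<delta>0 this] have S: "finite (S v1 v2)" "card (S v1 v2) \<le> \<rho>" for v1 v2
    by (simp_all add: S_def)
  have "(y - y) / \<delta> + 1 < real 2" for y :: real by simp
  from card_strip[OF \<delta>0 this] have L: "finite (L y)" "card (L y) \<le> 2" for y
    by (simp_all add: L_def)
  define side where "side = (\<lambda>j y. if replicate p j \<in> ?W then near_columns (replicate p j) \<times> L y else {})"
  have side: "finite (side j y)" "card (side j y) \<le> 2 * edge j" for j y
    using L[of y] by (auto simp: side_def edge_def card_cartesian_product mult.commute[of _ "card (L y)"])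
  define inner where "inner = (\<Union>(v1, v2)\<in>?W \<times> ?V. near_columns v1 \<times> S v1 v2)"
  have finWV: "finite (?W \<times> ?V)" by (simp add: finite_words)
  have inner_fin: "finite inner" unfolding inner_def using finWV S by auto
  have "card inner \<le> (\<Sum>x\<in>?W \<times> ?V. card (case x of (v1, v2) \<Rightarrow> near_columns v1 \<times> S v1 v2))"
    unfolding inner_def by (rule card_UN_le[OF finWV])
  also have "\<dots> \<le> (\<Sum>x\<in>?W \<times> ?V. case x of (v1, v2) \<Rightarrow> card (near_columns v1) * \<rho>)"
    by (intro sum_mono) (auto simp: card_cartesian_product S intro!: mult_le_mono2)
  also have "\<dots> = (\<Sum>v1\<in>?W. \<Sum>v2\<in>?V. card (near_columns v1) * \<rho>)"
    by (rule sum.cartesian_product[symmetric])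
  also have "\<dots> = \<rho> * card used_rows ^ l * (\<Sum>v\<in>?W. card (near_columns v))"
    by (simp add: card_words sum_distrib_left mult_ac)
  finally have inner: "card inner \<le> \<rho> * card used_rows ^ l * (\<Sum>v\<in>?W. card (near_columns v))" .
  let ?top = "(real (row_index w) + 1) / real m ^ k" and ?bot = "real (row_index w) / real m ^ k"
  let ?K = "int (column_index w * n ^ p)"
  let ?all = "inner \<union> side 0 ?top \<union> side (m - 1) ?bot"
  have sub: "T \<subseteq> (\<lambda>(c, r). (c + ?K, r)) ` ?all"
  proof
    fix b assume "b \<in> T"
    moreover obtain c r where b: "b = (c, r)" by (cases b)
    ultimately have "(c, r) \<in> touched \<delta> (word_map w ` unit_square \<inter> E)" by (simp add: T_def)
    then obtain v1 v2
      where v: "v1 \<in> ?W" "v2 \<in> ?V" "c - ?K \<in> near_columns v1"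
        "r \<in> S v1 v2 \<or> v1 = replicate p 0 \<and> r \<in> L ?top \<or> v1 = replicate p (m - 1) \<and> r \<in> L ?bot"
      by (rule touched_cover[OF w \<delta>, where l = l]) (rule that; simp only: S_def L_def)
    have "(c - ?K, r) \<in> ?all"
      using v(4)
    proof (elim disjE conjE)
      assume "r \<in> S v1 v2"
      then show ?thesis using v(1-3) unfolding inner_def by blast
    next
      assume "v1 = replicate p 0" "r \<in> L ?top"
      then show ?thesis using v(1,3) by (simp add: side_def)
    next
      assume "v1 = replicate p (m - 1)" "r \<in> L ?bot"
      then show ?thesis using v(1,3) by (simp add: side_def)
    qed
    then have "(\<lambda>(c, r). (c + ?K, r)) (c - ?K, r) \<in> (\<lambda>(c, r). (c + ?K, r)) ` ?all" by (rule imageI)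
    then show "b \<in> (\<lambda>(c, r). (c + ?K, r)) ` ?all" unfolding b by simp
  qed
  have fin: "finite ?all" using inner_fin side by simp
  then show "finite T" using sub by (rule finite_surj)
  have "card T \<le> card ?all" by (rule surj_card_le[OF fin sub])
  also have "\<dots> \<le> card inner + card (side 0 ?top) + card (side (m - 1) ?bot)"
    by (meson add_le_mono card_Un_le le_refl le_trans)
  finally show "card T \<le> \<rho> * card used_rows ^ l * (\<Sum>v\<in>?W. card (near_columns v))
              + 2 * edge 0 + 2 * edge (m - 1)"
    using inner side(2)[of 0 ?top] side(2)[of "m - 1" ?bot] by linarith
qed

text \<open>Every \<open>v\<close> has a nonempty fibre, so \<open>3 A + 2 \<le> 5 A\<close> with \<open>A\<close> its cardinality. For \<open>p > 0\<close> the two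
edge sequences are different, so that together their fibres have at most \<open>N\<^sup>p\<close> elements.\<close>

lemma touched_upper_pos:
  fixes \<rho> :: nat
  assumes w: "w \<in> words D k" and \<delta>: "\<delta> = 1 / real n ^ (k + p)" and p: "p > 0"
    and \<rho>: "real n ^ (k + p) / real m ^ (k + p + l) + 1 < real \<rho>"
  shows "card (touched \<delta> (word_map w ` unit_square \<inter> E))
           \<le> (5 * \<rho> * card used_rows ^ l + 10) * card D ^ p"
proof -
  let ?W = "words used_rows p"
  let ?edge = "\<lambda>j. if replicate p j \<in> ?W then card (near_columns (replicate p j)) else 0"
  have finW: "finite ?W" by (simp add: finite_words)
  have "(\<Sum>v\<in>?W. card (near_columns v)) \<le> (\<Sum>v\<in>?W. 5 * card (fibre v))"
    by (intro sum_mono card_near_columns_le)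
  then have all: "(\<Sum>v\<in>?W. card (near_columns v)) \<le> 5 * card D ^ p"
    by (simp add: sum_distrib_left[symmetric] sum_card_fibre)
  have ne: "replicate p 0 \<noteq> replicate p (m - 1)" using p m_ge_2 by (cases p) auto
  have "?edge 0 + ?edge (m - 1)
      = (\<Sum>v\<in>{replicate p 0, replicate p (m - 1)}. if v \<in> ?W then card (near_columns v) else 0)"
    using ne by simp
  also have "\<dots> = (\<Sum>v\<in>{replicate p 0, replicate p (m - 1)} \<inter> ?W. card (near_columns v))"
    by (simp add: sum.inter_restrict)
  also have "\<dots> \<le> (\<Sum>v\<in>?W. card (near_columns v))"
    using finW by (intro sum_mono2) auto
  finally have edges: "?edge 0 + ?edge (m - 1) \<le> 5 * card D ^ p" using all by linarith
  have "card (touched \<delta> (word_map w ` unit_square \<inter> E))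
      \<le> \<rho> * card used_rows ^ l * (\<Sum>v\<in>?W. card (near_columns v)) + 2 * ?edge 0 + 2 * ?edge (m - 1)"
    by (rule touched_upper(2)[OF w \<delta> \<rho>])
  also have "\<dots> \<le> \<rho> * card used_rows ^ l * (5 * card D ^ p) + 2 * (5 * card D ^ p)"
    using mult_le_mono2[OF all, of "\<rho> * card used_rows ^ l"] edges by linarith
  finally show ?thesis by (simp add: algebra_simps)
qed

text \<open>For \<open>p = 0\<close> the rectangle is one mesh column wide. If moreover \<open>l = 0\<close>, it is a single approximate
square and its edges meet no further mesh rows.\<close>

lemma touched_upper_0:
  fixes \<rho> :: nat
  assumes w: "w \<in> words D k" and \<delta>: "\<delta> = 1 / real n ^ k"
    and \<rho>: "real n ^ k / real m ^ (k + l) + 1 < real \<rho>"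
  shows "card (touched \<delta> (word_map w ` unit_square \<inter> E))
           \<le> 3 * \<rho> * card used_rows ^ l + (if l = 0 then 0 else 12)"
proof (cases "l = 0")
  case False
  have "card (touched \<delta> (word_map w ` unit_square \<inter> E))
      \<le> \<rho> * card used_rows ^ l * card (near_columns []) + 4 * card (near_columns [])"
    using touched_upper(2)[OF w, where p = 0 and l = l, of \<delta> \<rho>] \<delta> \<rho> by (simp add: add.commute)
  also have "\<dots> \<le> \<rho> * card used_rows ^ l * 3 + 4 * 3"
    using card_near_columns_Nil by (intro add_mono mult_le_mono2) auto
  finally show ?thesis using False by simp
next
  case True
  have \<delta>0: "\<delta> > 0" using n_ge_3 by (simp add: \<delta>)
  have m0: "real m > 0" using m_ge_2 by simp
  let ?K = "int (column_index w)"
  let ?a = "real (row_index w) / real m ^ k" and ?b = "(real (row_index w) + 1) / real m ^ k"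
  let ?S = "strip \<delta> ?a ?b"
  have "(?b - ?a) / \<delta> + 1 < real \<rho>"
    using \<rho> True by (simp add: \<delta> diff_divide_distrib[symmetric])
  from card_strip[OF \<delta>0 this] have S: "finite ?S" "card ?S \<le> \<rho>" by auto
  have ab: "?a \<le> ?b" using m0 by (simp add: divide_right_mono)
  have "touched \<delta> (word_map w ` unit_square \<inter> E) \<subseteq> (\<lambda>(c, r). (c + ?K, r)) ` (near_columns [] \<times> ?S)"
  proof
    fix b assume b: "b \<in> touched \<delta> (word_map w ` unit_square \<inter> E)"
    obtain c r where cr: "b = (c, r)" by (cases b)
    have \<delta>': "\<delta> = 1 / real n ^ (k + 0)" by (simp add: \<delta>)
    obtain v1 v2
      where "v1 = []" "v2 = []" "c - ?K \<in> near_columns v1"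
        "r \<in> ?S \<or> r \<in> strip \<delta> ?b ?b \<or> r \<in> strip \<delta> ?a ?a"
      by (rule touched_cover[OF w \<delta>' b[unfolded cr], where l = 0]) (rule that; simp)
    then have "c - ?K \<in> near_columns []" "r \<in> ?S"
      using ab by (auto simp: strip_def)
    then have "(\<lambda>(c, r). (c + ?K, r)) (c - ?K, r) \<in> (\<lambda>(c, r). (c + ?K, r)) ` (near_columns [] \<times> ?S)"
      by (intro imageI) simp
    then show "b \<in> (\<lambda>(c, r). (c + ?K, r)) ` (near_columns [] \<times> ?S)" unfolding cr by simp
  qed
  then have "card (touched \<delta> (word_map w ` unit_square \<inter> E)) \<le> card (near_columns [] \<times> ?S)"
    using S by (intro surj_card_le[where f = "\<lambda>(c, r). (c + ?K, r)"]) auto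
  also have "\<dots> \<le> 3 * \<rho>"
    using card_near_columns_Nil S by (auto simp: card_cartesian_product intro!: mult_le_mono)
  finally show ?thesis using True by simp
qed

text \<open>A carpet with one used row lies on a horizontal line, which meets at most two mesh rows. Four
columns per digit word suffice: \<open>3 A + 2 \<le> 4 A\<close> if \<open>A \<ge> 2\<close>, three columns suffice if \<open>p = 0\<close>, and a
carpet with one digit is a point.\<close>

lemma touched_one_row:
  assumes w: "w \<in> words D k" and \<delta>: "\<delta> = 1 / real n ^ (k + p)" and one: "card used_rows = 1"
  shows "card (touched \<delta> (word_map w ` unit_square \<inter> E)) \<le> 8 * card D ^ p"
proof -
  have \<delta>0: "\<delta> > 0" using n_ge_3 by (simp add: \<delta>)
  obtain j where j: "used_rows = {j}" using one card_1_singletonE by blast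
  define y0 where "y0 = real j / (real m - 1)"
  have y0: "snd z = y0" if "z \<in> E" for z
  proof -
    have "snd d = j" if "d \<in> D" for d using j that by (metis imageI singletonD)
    then have "real j \<le> real (snd d) \<and> real (snd d) \<le> real j" if "d \<in> D" for d using that by simp
    from snd_bounds[OF that this] show ?thesis by (simp add: y0_def)
  qed
  have line: "finite (strip \<delta> y y)" "card (strip \<delta> y y) \<le> 2" for y
    using card_strip[OF \<delta>0, of y y 2] by auto
  show ?thesis
  proof (cases "card D = 1")
    case True
    then obtain d where d: "D = {d}" using card_1_singletonE by blast
    define x0 where "x0 = real (fst d) / (real n - 1)"
    have x0: "fst z = x0" if "z \<in> E" for z
    proof -
      have "real (fst d) \<le> real (fst d') \<and> real (fst d') \<le> real (fst d)" if "d' \<in> D" for d'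
        using d that by simp
      from fst_bounds[OF that this] show ?thesis by (simp add: x0_def)
    qed
    have "touched \<delta> (word_map w ` unit_square \<inter> E) \<subseteq> strip \<delta> x0 x0 \<times> strip \<delta> y0 y0"
    proof
      fix b assume "b \<in> touched \<delta> (word_map w ` unit_square \<inter> E)"
      then obtain c r z where "b = (c, r)" "z \<in> E"
        "of_int c * \<delta> \<le> fst z" "fst z \<le> (of_int c + 1) * \<delta>"
        "of_int r * \<delta> \<le> snd z" "snd z \<le> (of_int r + 1) * \<delta>"
        unfolding touched_def by blast
      then show "b \<in> strip \<delta> x0 x0 \<times> strip \<delta> y0 y0"
        using x0[OF \<open>z \<in> E\<close>] y0[OF \<open>z \<in> E\<close>] by (simp add: strip_def)
    qed
    then have "card (touched \<delta> (word_map w ` unit_square \<inter> E)) \<le> card (strip \<delta> x0 x0 \<times> strip \<delta> y0 y0)"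
      using line by (intro card_mono) auto
    also have "\<dots> \<le> 2 * 2"
      unfolding card_cartesian_product using line by (intro mult_le_mono) auto
    finally show ?thesis using True by simp
  next
    case False
    then have D2: "2 \<le> card D" using card_D_pos by linarith
    let ?v = "replicate p j"
    let ?K = "int (column_index w * n ^ p)"
    have W: "words used_rows p = {?v}"
      unfolding j words_def by (auto simp: replicate_length_same intro: replicate_eqI)
    have "touched \<delta> (word_map w ` unit_square \<inter> E) \<subseteq> (\<lambda>(c, r). (c + ?K, r)) ` (near_columns ?v \<times> strip \<delta> y0 y0)"
    proof
      fix b assume b: "b \<in> touched \<delta> (word_map w ` unit_square \<inter> E)"
      obtain c r where cr: "b = (c, r)" by (cases b)
      obtain v1
        where "v1 \<in> words used_rows p" "c - ?K \<in> near_columns v1"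
        by (rule touched_cover[OF w \<delta> b[unfolded cr], where l = 0]) (rule that; assumption)
      then have "c - ?K \<in> near_columns ?v" using W by simp
      moreover have "r \<in> strip \<delta> y0 y0" using b y0 unfolding cr by (auto simp: touched_def strip_def)
      ultimately have "(\<lambda>(c, r). (c + ?K, r)) (c - ?K, r)
          \<in> (\<lambda>(c, r). (c + ?K, r)) ` (near_columns ?v \<times> strip \<delta> y0 y0)"
        by (intro imageI) simp
      then show "b \<in> (\<lambda>(c, r). (c + ?K, r)) ` (near_columns ?v \<times> strip \<delta> y0 y0)" unfolding cr by simp
    qed
    then have "card (touched \<delta> (word_map w ` unit_square \<inter> E)) \<le> card (near_columns ?v \<times> strip \<delta> y0 y0)"
      using line by (intro surj_card_le[where f = "\<lambda>(c, r). (c + ?K, r)"]) auto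
    also have "\<dots> \<le> card (near_columns ?v) * 2"
      unfolding card_cartesian_product using line by (intro mult_le_mono) auto
    also have "card (near_columns ?v) \<le> 4 * card D ^ p"
    proof (cases "p = 0")
      case True
      then show ?thesis using card_near_columns_Nil by simp
    next
      case False
      then have "2 \<le> card D ^ p" using D2 self_le_power[of "card D" p] by linarith
      moreover have "card (fibre ?v) = card D ^ p" using sum_card_fibre[of p] W by simp
      ultimately show ?thesis using card_near_columns[of ?v] by linarith
    qed
    finally show ?thesis by simp
  qed
qed

text \<open>Choose a point of the carpet in each approximate square of the rectangle, and for this point a mesh box
that contains it and lies in the column of the square. As \<open>\<delta>\<close> is at most the height of a
square, a box is chosen by at most three squares. Choosing the column exactly is what
avoids a factor nine.\<close>

lemma touched_lower:
  assumes w: "w \<in> words D k" and \<delta>: "\<delta> = 1 / real n ^ (k + p)"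
    and h: "real m ^ (k + p + l) \<le> real n ^ (k + p)"
    and fin: "finite (touched \<delta> (word_map w ` unit_square \<inter> E))"
  shows "card D ^ p * card used_rows ^ l \<le> 3 * card (touched \<delta> (word_map w ` unit_square \<inter> E))"
proof -
  have n0: "real n > 0" "real m > 0" using n_ge_3 m_ge_2 by auto
  have \<delta>0: "\<delta> > 0" using n0 by (simp add: \<delta>)
  let ?T = "touched \<delta> (word_map w ` unit_square \<inter> E)"
  let ?L = "k + p + l"
  obtain e0 where e0: "e0 \<in> E" using E_ne by blast
  \<comment> \<open>An approximate square prescribes only rows for its last \<open>l\<close> digits; \<open>lift\<close> completes them to digits.\<close>
  define lift where "lift = (\<lambda>v. SOME u. u \<in> fibre v)"
  have lift: "lift v \<in> words D l" "map snd (lift v) = v" if "v \<in> words used_rows l" for v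
  proof -
    have "lift v \<in> fibre v" unfolding lift_def using fibre_nonempty[OF that] by (simp add: some_in_eq)
    then show "lift v \<in> words D l" "map snd (lift v) = v"
      using that by (auto simp: fibre_def words_def)
  qed
  define pt where "pt = (\<lambda>(u, v). word_map (w @ u @ lift v) e0)"
  define Y where "Y = (\<lambda>(u :: (nat \<times> nat) list, v). place_value m (map snd w @ map snd u @ v))"
  define F where "F = (\<lambda>q. (int (column_index w * n ^ p + column_index (fst q)), \<lfloor>snd (pt q) / \<delta>\<rfloor>))"
  let ?S = "words D p \<times> words used_rows l"
  have len_w: "length w = k" using w by (simp add: words_def)
  have props: "pt q \<in> word_map w ` unit_square \<inter> E"
      "of_int (fst (F q)) * \<delta> \<le> fst (pt q)" "fst (pt q) \<le> (of_int (fst (F q)) + 1) * \<delta>"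
      "real (Y q) \<le> snd (pt q) * real m ^ ?L" "snd (pt q) * real m ^ ?L \<le> real (Y q) + 1"
    if q0: "q \<in> ?S" for q
  proof -
    obtain u v where q: "q = (u, v)" "u \<in> words D p" "v \<in> words used_rows l"
      using q0 by (rule SigmaE)
    have lu: "length u = p" using q by (simp add: words_def)
    have uv: "u @ lift v \<in> words D (p + l)" and wuv: "w @ u @ lift v \<in> words D ?L"
      using w q lift(1)[OF q(3)] by (auto simp: words_def)
    define y where "y = word_map (u @ lift v) e0"
    define x where "x = word_map (lift v) e0"
    have y: "y \<in> E" and x: "x \<in> E"
      unfolding y_def x_def using E_word_image uv lift(1)[OF q(3)] e0 by blast+
    have py: "pt q = word_map w y" by (simp add: pt_def q(1) y_def word_map_append)
    have "y \<in> unit_square" using E_in_square[OF y] by (cases y) auto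
    then show "pt q \<in> word_map w ` unit_square \<inter> E"
      using E_word_image[OF w y] unfolding py by blast
    have "pt q = word_map (w @ u) x" by (simp add: pt_def q(1) x_def word_map_append)
    then have fp: "fst (pt q) = (fst x + of_int (fst (F q))) * \<delta>"
      by (simp add: word_map_eq F_def q(1) \<delta> len_w lu place_value_append)
    show "of_int (fst (F q)) * \<delta> \<le> fst (pt q)" "fst (pt q) \<le> (of_int (fst (F q)) + 1) * \<delta>"
      unfolding fp using E_in_square[OF x] \<delta>0 by (simp_all add: mult_right_mono)
    have "row_index (w @ u @ lift v) = Y q" using lift(2)[OF q(3)] by (simp add: Y_def q(1))
    moreover have "length (w @ u @ lift v) = ?L" using wuv by (simp add: words_def)
    ultimately have "snd (pt q) * real m ^ ?L = snd e0 + Y q"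
      using n0 unfolding pt_def q(1) by (simp only: prod.case word_map_eq snd_conv) simp
    then show "real (Y q) \<le> snd (pt q) * real m ^ ?L" "snd (pt q) * real m ^ ?L \<le> real (Y q) + 1"
      using E_in_square[OF e0] by linarith+
  qed
  have fl: "of_int \<lfloor>y / \<delta>\<rfloor> * \<delta> \<le> y" "y \<le> (of_int \<lfloor>y / \<delta>\<rfloor> + 1) * \<delta>" for y
    using floor_divide_lower[OF \<delta>0, of y] floor_divide_upper[OF \<delta>0, of y] by auto
  have "F q \<in> ?T" if "q \<in> ?S" for q
    using props[OF that] fl[of "snd (pt q)"] unfolding touched_def by (auto simp: F_def intro!: bexI[of _ "pt q"])
  then have img: "F ` ?S \<subseteq> ?T" by blast
  have finS: "finite ?S" by (simp add: finite_words)
  have "card ?S \<le> 3 * card ?T"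
  proof (rule card_le_fibres[OF finS fin img])
    fix b assume "b \<in> ?T"
    obtain c r where b: "b = (c, r)" by (cases b)
    let ?X = "{q\<in>?S. F q = b}"
    let ?lo = "of_int r * \<delta> * real m ^ ?L - 1" and ?hi = "(of_int r + 1) * \<delta> * real m ^ ?L"
    have "\<delta> * real m ^ ?L \<le> 1" using h n0 by (simp add: \<delta> divide_le_eq)
    then have "?hi - ?lo < real 3" by (simp add: algebra_simps)
    note ints = card_int_between[OF this]
    have inj: "inj_on (\<lambda>q. int (Y q)) ?X"
    proof (rule inj_onI)
      fix q q' assume qq: "q \<in> ?X" "q' \<in> ?X" "int (Y q) = int (Y q')"
      have "q \<in> ?S" "q' \<in> ?S" using qq by blast+
      then obtain u v u' v' where q: "q = (u, v)" "u \<in> words D p" "v \<in> words used_rows l"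
        "q' = (u', v')" "u' \<in> words D p" "v' \<in> words used_rows l" by (elim SigmaE)
      have len: "length u = p" "length u' = p" "length v = l" "length v' = l"
        using q by (auto simp: words_def)
      have "F q = F q'" using qq by simp
      then have "column_index u = column_index u'" by (simp add: F_def q(1,4))
      then have 1: "map fst u = map fst u'"
        using len by (intro place_value_inj[OF map_fst_digits[OF q(2)] map_fst_digits[OF q(5)]]) simp
      have vs: "set v \<subseteq> {..<m}" "set v' \<subseteq> {..<m}"
        using q(3,6) used_rows_sub unfolding words_def by blast+
      have dig: "set (map snd w @ map snd u @ v) \<subseteq> {..<m}" "set (map snd w @ map snd u' @ v') \<subseteq> {..<m}"
        using map_snd_digits[OF w] map_snd_digits[OF q(2)] map_snd_digits[OF q(5)] vs
        by simp_all
      have "map snd w @ map snd u @ v = map snd w @ map snd u' @ v'"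
        using dig len qq(3) by (intro place_value_inj[of _ m]) (auto simp: Y_def q(1,4))
      then have 2: "map snd u = map snd u'" "v = v'" using len by auto
      have "u = u'" using 1 2(1) by (metis zip_map_fst_snd)
      then show "q = q'" using 2 q by simp
    qed
    have "(\<lambda>q. int (Y q)) ` ?X \<subseteq> {y::int. ?lo \<le> of_int y \<and> of_int y \<le> ?hi}"
    proof
      fix y assume "y \<in> (\<lambda>q. int (Y q)) ` ?X"
      then obtain q where q: "q \<in> ?S" "F q = b" "y = int (Y q)" by auto
      have r: "r = \<lfloor>snd (pt q) / \<delta>\<rfloor>" using q(2) by (simp add: F_def b)
      have "of_int r * \<delta> * real m ^ ?L \<le> snd (pt q) * real m ^ ?L"
        "snd (pt q) * real m ^ ?L \<le> ?hi"
        using fl[of "snd (pt q)"] n0 unfolding r by (auto intro!: mult_right_mono)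
      then show "y \<in> {y::int. ?lo \<le> of_int y \<and> of_int y \<le> ?hi}"
        using props(4,5)[OF q(1)] unfolding q(3) mem_Collect_eq of_int_of_nat_eq by linarith
    qed
    then have "card ((\<lambda>q. int (Y q)) ` ?X) \<le> 3"
      using ints card_mono order_trans by blast
    then show "card ?X \<le> 3" using inj by (simp add: card_image)
  qed
  then show ?thesis by (simp add: card_cartesian_product card_words)
qed

end

section \<open>Inequalities for the constant of the upper bound\<close>

lemma powr_le_chord:
  fixes m f :: real
  assumes "m > 0" "0 \<le> f" "f \<le> 1"
  shows "m powr f \<le> 1 + f * (m - 1)"
proof -
  have "exp ((1 - f) *\<^sub>R 0 + f *\<^sub>R ln m) \<le> (1 - f) * exp 0 + f * exp (ln m)"
    using assms by (intro convex_onD[OF exp_convex]) auto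
  then show ?thesis using assms by (simp add: powr_def algebra_simps)
qed

lemma two_powr_ge: "0 \<le> f \<Longrightarrow> 1 + f / 2 \<le> 2 powr (f::real)"
proof -
  assume f: "0 \<le> f"
  have "1 + f / 2 \<le> 1 + f * ln 2" using mult_left_mono[of "1/2" "ln 2" f] f ln2_ge_two_thirds by simp
  also have "\<dots> \<le> exp (f * ln 2)" by (rule exp_ge_add_one_self)
  finally show ?thesis by (simp add: powr_def)
qed

lemma powr_power_mono:
  fixes a b x y :: real
  assumes "x > 0" "y > 0" "y ^ i \<le> x ^ j" "0 \<le> t"
  shows "(y powr t) ^ i \<le> (x powr t) ^ j"
proof -
  have "(y ^ i) powr t \<le> (x ^ j) powr t" using assms by (intro powr_mono2) auto
  then show ?thesis using assms by (simp add: powr_power powr_powr powr_realpow[symmetric] mult.commute)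
qed

text \<open>Replacing both powers by affine functions of \<open>t\<close>, namely the chord of \<open>m\<^sup>t\<close> over \<open>[0, 1]\<close> and the
lower bound \<open>1 + t/2\<close> of \<open>2\<^sup>t\<close>, leaves \<open>(m - 3) (3 t - 4) \<le> 0\<close>.\<close>

lemma two_row_budget:
  fixes m t :: real
  assumes m: "3 \<le> m" and f: "0 \<le> t" "t \<le> 1"
  shows "5 * (m powr t + 2) + 5 \<le> 4 * (m + 2) * 2 powr t"
proof -
  have "5 * (m powr t + 2) + 5 \<le> 5 * (1 + t * (m - 1) + 2) + 5"
    using powr_le_chord[of m t] assms by simp
  also have "\<dots> \<le> 4 * (m + 2) * (1 + t / 2)"
  proof -
    have "(m - 3) * (3 * t - 4) \<le> 0" using assms by (intro mult_nonneg_nonpos) auto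
    then show ?thesis by (simp add: algebra_simps)
  qed
  also have "\<dots> \<le> 4 * (m + 2) * 2 powr t"
    using two_powr_ge[OF f(1)] m by (intro mult_left_mono) auto
  finally show ?thesis .
qed

text \<open>The lower bounds on \<open>m\<^sup>t\<close> bound \<open>2\<^sup>t\<close> from below: \<open>2\<^sup>t\<close> is compared with a power
of \<open>m\<^sup>t\<close> by an inequality between powers of \<open>2\<close> and \<open>m\<close>, namely \<open>3 \<le> 2\<^sup>2\<close>, \<open>3\<^sup>3 \<le> 2\<^sup>5\<close>, \<open>4 \<le> 2\<^sup>2\<close> or \<open>5 \<le> 2\<^sup>3\<close>; for \<open>m \<ge> 6\<close>
the trivial bound \<open>2\<^sup>t \<ge> 1\<close> suffices.\<close>

lemma two_row_budget_short:
  fixes m :: nat and t :: real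
  assumes m: "3 \<le> m" and t: "0 \<le> t" and g: "((m + 1) / m)\<^sup>2 \<le> real m powr t"
  shows "25 \<le> 4 * (real m + 2) * 2 powr t"
    and "m = 3 \<Longrightarrow> 2 \<le> real m powr t \<Longrightarrow> 30 \<le> 4 * (real m + 2) * 2 powr t"
    and "m \<noteq> 3 \<Longrightarrow> 30 \<le> 4 * (real m + 2) * 2 powr t"
proof -
  let ?a = "2 powr t"
  have a1: "1 \<le> ?a" using two_powr_ge[OF t] t by linarith
  show three: "30 \<le> 4 * (real m + 2) * ?a" if "m = 3" "2 \<le> real m powr t"
  proof -
    have "(real m powr t) ^ 3 \<le> ?a ^ 5"
      using t by (intro powr_power_mono) (auto simp: that(1))
    moreover have "(2::real) ^ 3 \<le> (real m powr t) ^ 3" using that by (intro power_mono) auto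
    ultimately have "(3/2) ^ 5 < ?a ^ 5" by (simp add: power_divide)
    then have "3/2 < ?a" by (rule power_less_imp_less_base) (use a1 in linarith)
    then show ?thesis using that by simp
  qed
  show big: "30 \<le> 4 * (real m + 2) * ?a" if m3: "m \<noteq> 3"
  proof -
    consider "m = 4" | "m = 5" | "6 \<le> m" using m m3 by linarith
    then show ?thesis
    proof cases
      case 1
      have "(real m powr t) ^ 1 \<le> ?a ^ 2" using t by (intro powr_power_mono) (auto simp: 1)
      moreover have "(5/4)\<^sup>2 \<le> (real m powr t) ^ 1" using g by (simp add: 1)
      ultimately have "(5/4)\<^sup>2 \<le> ?a\<^sup>2" by (rule order_trans[rotated])
      then have "5/4 \<le> ?a" by (rule power2_le_imp_le) (use a1 in linarith)
      then show ?thesis by (simp add: 1)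
    next
      case 2
      have "(real m powr t) ^ 1 \<le> ?a ^ 3" using t by (intro powr_power_mono) (auto simp: 2)
      then have "(15/14)^3 < ?a^3" using g by (simp add: 2 power_divide)
      then have "15/14 < ?a" by (rule power_less_imp_less_base) (use a1 in linarith)
      then show ?thesis by (simp add: 2)
    next
      case 3
      then have "30 * 1 \<le> 4 * (real m + 2) * ?a" using a1 by (intro mult_mono) auto
      then show ?thesis by simp
    qed
  qed
  show "25 \<le> 4 * (real m + 2) * ?a"
  proof (cases "m = 3")
    case True
    have "(real m powr t) ^ 1 \<le> ?a ^ 2" using t by (intro powr_power_mono) (auto simp: True)
    moreover have "(4/3)\<^sup>2 \<le> (real m powr t) ^ 1" using g by (simp add: True)
    ultimately have "(4/3)\<^sup>2 \<le> ?a\<^sup>2" by (rule order_trans[rotated])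
    then have "4/3 \<le> ?a" by (rule power2_le_imp_le) (use a1 in linarith)
    then show ?thesis by (simp add: True)
  next
    case False
    then show ?thesis using big by linarith
  qed
qed

context carpet
begin

section \<open>Approximate squares and the box dimension\<close>

text \<open>The real number \<open>t = q (1/\<sigma> - 1)\<close> with \<open>\<sigma> = log m / log n\<close> solves \<open>m\<^sup>q\<^sup>+\<^sup>t = n\<^sup>q\<close>: it is the number of
rows that have to follow \<open>q\<close> digits to make a cell of width \<open>n\<^sup>-\<^sup>q\<close> square. Rounding it down gives the
approximate squares, whose height in mesh units then lies in \<open>[1, m)\<close>.\<close>

definition surplus :: "nat \<Rightarrow> real" where
  "surplus q = real q * (ln (real n) / ln (real m) - 1)"

definition extra :: "nat \<Rightarrow> nat" where
  "extra q = nat \<lfloor>surplus q\<rfloor>"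

text \<open>This is \<open>log\<^sub>n (N s\<^sup>1\<^sup>/\<^sup>\<sigma>\<^sup>-\<^sup>1)\<close>.\<close>

definition carpet_dim :: real where
  "carpet_dim = (ln (real (card D)) + (ln (real n) / ln (real m) - 1) * ln (real (card used_rows))) / ln (real n)"

lemma log_ratio_pos: "ln (real n) / ln (real m) - 1 > 0"
  using m_ge_2 m_less_n by (simp add: field_simps)

lemma surplus_nonneg: "0 \<le> surplus q"
  using log_ratio_pos by (simp add: surplus_def)

lemma powr_surplus: "real m powr surplus q = (real n / real m) ^ q"
proof -
  have "ln (real m) > 0" using m_ge_2 by simp
  then have "surplus q * ln (real m) = real q * (ln (real n) - ln (real m))"
    by (simp add: surplus_def field_simps)
  also have "\<dots> = real q * ln (real n / real m)" using m_ge_2 m_less_n by (simp add: ln_div)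
  finally have "real m powr surplus q = exp (real q * ln (real n / real m))"
    using m_ge_2 by (simp add: powr_def)
  then show ?thesis using m_ge_2 m_less_n by (simp add: exp_of_nat_mult)
qed

lemma extra_bounds: "real (extra q) \<le> surplus q" "surplus q < real (extra q) + 1"
  using surplus_nonneg[of q] unfolding extra_def by linarith+

lemma square_ratio: "real n ^ q / real m ^ (q + l) = real m powr (surplus q - real l)"
  using m_ge_2 by (simp add: powr_diff powr_surplus powr_realpow power_add power_divide)

lemma extra_ratio:
  "1 \<le> real n ^ q / real m ^ (q + extra q)" "real n ^ q / real m ^ (q + extra q) < real m"
proof -
  show "1 \<le> real n ^ q / real m ^ (q + extra q)"
    unfolding square_ratio using extra_bounds[of q] m_ge_2 by (intro ge_one_powr_ge_zero) auto
  have "real m powr (surplus q - real (extra q)) < real m powr 1"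
    using extra_bounds[of q] m_ge_2 by (intro powr_less_mono) auto
  then show "real n ^ q / real m ^ (q + extra q) < real m"
    unfolding square_ratio using m_ge_2 by simp
qed

lemma rows_power_bounds:
  "real (card used_rows) ^ extra q \<le> real (card used_rows) powr surplus q"
  "real (card used_rows) powr surplus q \<le> real (card used_rows) * real (card used_rows) ^ extra q"
proof -
  have s: "1 \<le> real (card used_rows)" using card_used_rows_pos by linarith
  have "real (card used_rows) powr real (extra q) \<le> real (card used_rows) powr surplus q"
    using extra_bounds[of q] s by (intro powr_mono) auto
  then show "real (card used_rows) ^ extra q \<le> real (card used_rows) powr surplus q"
    using s by (simp add: powr_realpow)
  have "real (card used_rows) powr surplus q \<le> real (card used_rows) powr real (Suc (extra q))"
    using extra_bounds[of q] s by (intro powr_mono) auto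
  then show "real (card used_rows) powr surplus q \<le> real (card used_rows) * real (card used_rows) ^ extra q"
    using s powr_realpow[of "real (card used_rows)" "Suc (extra q)"] by simp
qed

text \<open>At the scale \<open>n\<^sup>-\<^sup>q\<close> the power law is, up to a factor between \<open>1\<close> and \<open>s\<close>, the number
\<open>N\<^sup>q s\<^sup>l\<close> of approximate squares of the whole carpet.\<close>

lemma scale_powr_dim:
  "(1 / real n ^ q) powr (- carpet_dim) = real (card D) ^ q * real (card used_rows) powr surplus q"
proof -
  have N: "real (card D) > 0" and s: "real (card used_rows) > 0" and n: "ln (real n) > 0" "real n > 0"
    using card_D_pos card_used_rows_pos n_ge_3 by auto
  have "- carpet_dim * ln (1 / real n ^ q) = real q * (carpet_dim * ln (real n))"
    using n by (simp add: ln_div ln_realpow)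
  also have "carpet_dim * ln (real n) = ln (real (card D)) + (ln (real n) / ln (real m) - 1) * ln (real (card used_rows))"
    using n by (simp add: carpet_dim_def)
  also have "real q * \<dots> = real q * ln (real (card D)) + surplus q * ln (real (card used_rows))"
    by (simp add: surplus_def algebra_simps)
  finally have "(1 / real n ^ q) powr (- carpet_dim) = exp (real q * ln (real (card D)) + surplus q * ln (real (card used_rows)))"
    using n by (simp add: powr_def)
  also have "\<dots> = real (card D) ^ q * real (card used_rows) powr surplus q"
    using N s D_ne by (simp add: exp_add exp_of_nat_mult powr_def)
  finally show ?thesis .
qed

lemma finite_touched:
  assumes "w \<in> words D k"
  shows "finite (touched (1 / real n ^ (k + p)) (word_map w ` unit_square \<inter> E))"
  using touched_upper(1)[OF assms refl, where l = "extra (k + p)" and \<rho> = "m + 1"] extra_ratio(2)[of "k + p"]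
  by simp

lemma touched_lower_powr:
  assumes "w \<in> words D k"
  shows "real (card D) ^ p * real (card used_rows) powr surplus (k + p)
      \<le> 3 * real (card used_rows) * card (touched (1 / real n ^ (k + p)) (word_map w ` unit_square \<inter> E))"
proof -
  let ?T = "touched (1 / real n ^ (k + p)) (word_map w ` unit_square \<inter> E)"
  let ?s = "real (card used_rows)"
  have "real m ^ (k + p + extra (k + p)) \<le> real n ^ (k + p)"
    using extra_ratio(1)[of "k + p"] m_ge_2 by (simp add: le_divide_eq)
  from touched_lower[OF assms refl this finite_touched[OF assms]]
  have "card D ^ p * card used_rows ^ extra (k + p) \<le> 3 * card ?T" .
  then have "real (card D ^ p * card used_rows ^ extra (k + p)) \<le> real (3 * card ?T)" by (rule of_nat_mono)
  then have *: "real (card D) ^ p * ?s ^ extra (k + p) \<le> 3 * card ?T" by simp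
  have "real (card D) ^ p * ?s powr surplus (k + p) \<le> real (card D) ^ p * (?s * ?s ^ extra (k + p))"
    using rows_power_bounds(2) by (intro mult_left_mono) auto
  also have "\<dots> = ?s * (real (card D) ^ p * ?s ^ extra (k + p))" by simp
  also have "\<dots> \<le> ?s * (3 * card ?T)" using * by (intro mult_left_mono) auto
  finally show ?thesis by (simp add: mult_ac)
qed

lemma word_map_Nil_E: "word_map [] ` unit_square \<inter> E = E"
  using E_in_square by auto

text \<open>The unit square is the basic rectangle of the empty word, so the counts in basic rectangles include
the one for the whole carpet.\<close>

lemma E_count_bounds:
  defines "C \<equiv> 5 * real m + 15"
  shows "finite (touched (1 / real n ^ q) E)"
    "(1 / real n ^ q) powr (- carpet_dim) \<le> 3 * real (card used_rows) * card (touched (1 / real n ^ q) E)"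
    "q > 0 \<Longrightarrow> card (touched (1 / real n ^ q) E) \<le> C * (1 / real n ^ q) powr (- carpet_dim)"
proof -
  have w: "[] \<in> words D 0" by simp
  let ?T = "touched (1 / real n ^ q) E"
  let ?s = "real (card used_rows)" and ?l = "extra q"
  show "finite ?T" using finite_touched[OF w, of q] by (simp only: word_map_Nil_E add_0)
  show "(1 / real n ^ q) powr (- carpet_dim) \<le> 3 * ?s * card ?T"
    using touched_lower_powr[OF w, of q] by (simp only: word_map_Nil_E add_0 scale_powr_dim)
  assume q: "q > 0"
  have "real n ^ (0 + q) / real m ^ (0 + q + ?l) + 1 < real (m + 1)"
    using extra_ratio(2)[of q] by simp
  from touched_upper_pos[OF w refl q this]
  have "card ?T \<le> (5 * (m + 1) * card used_rows ^ ?l + 10) * card D ^ q"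
    by (simp only: word_map_Nil_E add_0)
  then have "real (card ?T) \<le> real ((5 * (m + 1) * card used_rows ^ ?l + 10) * card D ^ q)"
    by (rule of_nat_mono)
  also have "\<dots> = (5 * (real m + 1) * ?s ^ ?l + 10) * real (card D) ^ q" by simp
  also have "\<dots> \<le> (C * ?s ^ ?l) * real (card D) ^ q"
  proof (rule mult_right_mono)
    have "1 \<le> ?s ^ ?l" using card_used_rows_pos by (intro one_le_power) linarith
    then show "5 * (real m + 1) * ?s ^ ?l + 10 \<le> C * ?s ^ ?l" by (simp add: C_def algebra_simps)
  qed simp
  also have "\<dots> \<le> (C * ?s powr surplus q) * real (card D) ^ q"
    using rows_power_bounds(1)[of q] by (intro mult_right_mono mult_left_mono) (auto simp: C_def)
  finally show "card ?T \<le> C * (1 / real n ^ q) powr (- carpet_dim)"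
    by (simp add: scale_powr_dim mult_ac)
qed

lemma carpet_dim_nonneg: "0 \<le> carpet_dim"
proof -
  have "ln (real (card D)) \<ge> 0" "ln (real (card used_rows)) \<ge> 0" "ln (real n) > 0"
    using card_D_pos card_used_rows_pos n_ge_3 by (auto intro!: ln_ge_zero)
  then show ?thesis using log_ratio_pos by (simp add: carpet_dim_def)
qed

text \<open>A general \<open>\<delta>\<close> lies between consecutive powers \<open>n\<^sup>-\<^sup>q\<^sup>-\<^sup>1\<close> and \<open>n\<^sup>-\<^sup>q\<close>; the resulting errors in
\<open>q log n\<close> and in the count are bounded and vanish after division by \<open>- log \<delta>\<close>.\<close>

lemma ln_count_bounds:
  "\<exists>c. \<forall>\<delta>. 0 < \<delta> \<longrightarrow> \<delta> < 1 \<longrightarrow>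
     carpet_dim * (- ln \<delta>) - c \<le> ln (real (mesh_count \<delta> E)) \<and>
     ln (real (mesh_count \<delta> E)) \<le> carpet_dim * (- ln \<delta>) + c"
proof -
  let ?C = "5 * real m + 15" and ?s = "real (card used_rows)"
  let ?n = "real n"
  have n: "ln ?n > 0" "?n > 0" using n_ge_3 by auto
  have s: "?s > 0" using card_used_rows_pos by simp
  define c where "c = carpet_dim * ln ?n + \<bar>ln (27 * ?s)\<bar> + \<bar>ln (9 * ?C)\<bar>"
  have "carpet_dim * (- ln \<delta>) - c \<le> ln (real (mesh_count \<delta> E)) \<and> ln (real (mesh_count \<delta> E)) \<le> carpet_dim * (- ln \<delta>) + c"
    if \<delta>: "0 < \<delta>" "\<delta> < 1" for \<delta>
  proof -
    define x where "x = - ln \<delta> / ln ?n"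
    have x0: "x > 0" unfolding x_def using \<delta> n by (intro divide_pos_pos) auto
    define q where "q = nat \<lfloor>x\<rfloor>"
    have q: "real q \<le> x" "x < real q + 1" using x0 unfolding q_def by linarith+
    have lnd: "ln \<delta> = - x * ln ?n" using n by (simp add: x_def)
    have lnq: "ln (1 / ?n ^ i) = - real i * ln ?n" for i using n by (simp add: ln_div ln_realpow)
    have "ln \<delta> \<le> ln (1 / ?n ^ q)" unfolding lnd lnq using q n by (simp add: mult_right_mono)
    then have d1: "\<delta> \<le> 1 / ?n ^ q" using \<delta> n by (subst (asm) ln_le_cancel_iff) auto
    have "x * ln ?n \<le> (real q + 1) * ln ?n" using q n by (intro mult_right_mono) auto
    then have "ln (1 / ?n ^ Suc q) \<le> ln \<delta>" unfolding lnd lnq by (simp add: algebra_simps)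
    then have d2: "1 / ?n ^ Suc q \<le> \<delta>" using \<delta> n by (subst (asm) ln_le_cancel_iff) auto
    have pos: "1 / ?n ^ Suc q > 0" using n by simp
    note coarse2 = touched_coarser[OF pos d2 E_count_bounds(1)[of "Suc q"]]
    note coarse1 = touched_coarser(2)[OF \<delta>(1) d1 coarse2(1)]
    let ?M = "real (mesh_count \<delta> E)"
    have M: "mesh_count \<delta> E = card (touched \<delta> E)" by (rule mesh_count_eq_card_touched[OF \<delta>(1)])
    have p: "(1 / ?n ^ i) powr (- carpet_dim) = exp (carpet_dim * (real i * ln ?n))" for i
      using n lnq[of i] by (simp add: powr_def)
    have "exp (carpet_dim * (real q * ln ?n)) \<le> 3 * ?s * card (touched (1 / ?n ^ q) E)"
      using E_count_bounds(2)[of q] by (simp only: p)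
    also have "\<dots> \<le> 3 * ?s * (9 * ?M)"
      using coarse1 s unfolding M by (intro mult_left_mono) auto
    finally have lo: "exp (carpet_dim * (real q * ln ?n)) \<le> 27 * ?s * ?M" by simp
    then have M0: "?M > 0" using s by (smt (verit) exp_gt_zero zero_less_mult_pos mult_pos_pos)
    have "ln (exp (carpet_dim * (real q * ln ?n))) \<le> ln (27 * ?s * ?M)"
      using lo s M0 by (subst ln_le_cancel_iff) auto
    then have lo': "carpet_dim * (real q * ln ?n) \<le> ln (27 * ?s) + ln ?M"
      using s M0 D_ne by (simp add: ln_mult)
    have "?M \<le> 9 * real (card (touched (1 / ?n ^ Suc q) E))" using coarse2(2) unfolding M by linarith
    also have "\<dots> \<le> 9 * (?C * exp (carpet_dim * (real (Suc q) * ln ?n)))"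
      using E_count_bounds(3)[OF zero_less_Suc, of q] unfolding p by (rule mult_left_mono) simp
    finally have "?M \<le> 9 * ?C * exp (carpet_dim * (real (Suc q) * ln ?n))" by (simp only: mult.assoc)
    then have "ln ?M \<le> ln (9 * ?C * exp (carpet_dim * (real (Suc q) * ln ?n)))"
      using M0 by (rule ln_mono)
    then have hi': "ln ?M \<le> ln (9 * ?C) + carpet_dim * (real (Suc q) * ln ?n)"
      by (subst (asm) ln_mult) (auto simp: add_pos_pos)
    have "x * ln ?n \<le> real q * ln ?n + ln ?n" using q n mult_right_mono[of x "real q + 1" "ln ?n"]
      by (simp add: algebra_simps)
    then have b1: "carpet_dim * (x * ln ?n) \<le> carpet_dim * (real q * ln ?n) + carpet_dim * ln ?n"
      using mult_left_mono[OF _ carpet_dim_nonneg] by (metis distrib_left)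
    have "real (Suc q) * ln ?n \<le> x * ln ?n + ln ?n" using q n mult_right_mono[of "real q" x "ln ?n"]
      by (simp add: algebra_simps)
    then have b2: "carpet_dim * (real (Suc q) * ln ?n) \<le> carpet_dim * (x * ln ?n) + carpet_dim * ln ?n"
      using mult_left_mono[OF _ carpet_dim_nonneg] by (metis distrib_left)
    have ln\<delta>: "- ln \<delta> = x * ln ?n" by (simp add: lnd)
    have "c \<ge> carpet_dim * ln ?n + ln (27 * ?s)" "c \<ge> carpet_dim * ln ?n + ln (9 * ?C)"
      unfolding c_def by linarith+
    then show ?thesis using lo' hi' b1 b2 unfolding ln\<delta> by linarith
  qed
  then show ?thesis by blast
qed

lemma box_dim_eq: "box_dim E = carpet_dim"
proof -
  obtain c where c: "\<And>\<delta>. 0 < \<delta> \<Longrightarrow> \<delta> < 1 \<Longrightarrow> 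
     carpet_dim * (- ln \<delta>) - c \<le> ln (real (mesh_count \<delta> E)) \<and> ln (real (mesh_count \<delta> E)) \<le> carpet_dim * (- ln \<delta>) + c"
    using ln_count_bounds by blast
  let ?f = "\<lambda>\<delta>. ln (real (mesh_count \<delta> E)) / - ln \<delta>"
  have inf: "filterlim (\<lambda>\<delta>::real. - ln \<delta>) at_top (at_right 0)"
    using ln_at_0 by (simp add: filterlim_uminus_at_top)
  then have z: "((\<lambda>\<delta>::real. c / - ln \<delta>) \<longlongrightarrow> 0) (at_right 0)"
    by (intro tendsto_divide_0[OF tendsto_const] filterlim_at_top_imp_at_infinity)
  have ev: "eventually (\<lambda>\<delta>::real. 0 < \<delta> \<and> \<delta> < 1) (at_right 0)"
    using eventually_at_right_real[of 0 1] by (auto elim: eventually_mono)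
  have "(?f \<longlongrightarrow> carpet_dim) (at_right 0)"
  proof (rule tendsto_sandwich)
    show "((\<lambda>\<delta>. carpet_dim - c / - ln \<delta>) \<longlongrightarrow> carpet_dim) (at_right 0)"
      using tendsto_diff[OF tendsto_const[of carpet_dim] z] by simp
    show "((\<lambda>\<delta>. carpet_dim + c / - ln \<delta>) \<longlongrightarrow> carpet_dim) (at_right 0)"
      using tendsto_add[OF tendsto_const[of carpet_dim] z] by simp
    show "eventually (\<lambda>\<delta>. carpet_dim - c / - ln \<delta> \<le> ?f \<delta>) (at_right 0)"
      using ev
    proof eventually_elim
      case (elim \<delta>)
      define d where "d = - ln \<delta>"
      have "d > 0" using elim by (simp add: d_def)
      then have "carpet_dim - c / d = (carpet_dim * d - c) / d" by (simp add: diff_divide_distrib)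
      then show ?case using c[of \<delta>, folded d_def] elim \<open>d > 0\<close>
        unfolding d_def[symmetric] by (simp add: divide_right_mono)
    qed
    show "eventually (\<lambda>\<delta>. ?f \<delta> \<le> carpet_dim + c / - ln \<delta>) (at_right 0)"
      using ev
    proof eventually_elim
      case (elim \<delta>)
      define d where "d = - ln \<delta>"
      have "d > 0" using elim by (simp add: d_def)
      then have "carpet_dim + c / d = (carpet_dim * d + c) / d" by (simp add: add_divide_distrib)
      then show ?case using c[of \<delta>, folded d_def] elim \<open>d > 0\<close>
        unfolding d_def[symmetric] by (simp add: divide_right_mono)
    qed
  qed
  then show ?thesis unfolding box_dim_def by (intro tendsto_Lim) auto
qed

section \<open>The constant of the upper bound\<close>

lemma card_used_rows_le: "card used_rows \<le> m"
  using card_mono[OF finite_lessThan used_rows_sub] by simp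

text \<open>Let \<open>s\<close> be the number of used rows. In the crude estimate an approximate square meets \<open>m + 1\<close> mesh
rows. This suffices for \<open>s \<ge> 3\<close> and for \<open>p = 0\<close>. For \<open>s = 2\<close> and \<open>p > 0\<close> the constant leaves
little room, and \<open>s\<^sup>t\<close> is used in place of its lower bound \<open>s\<^sup>l\<close>, together with the sharper row
bound \<open>h + 2\<close> for squares of height \<open>h\<close> in mesh units.\<close>

lemma touched_upper_powr:
  assumes w: "w \<in> words D k" and k: "k > 0"
  shows "card (touched (1 / real n ^ (k + p)) (word_map w ` unit_square \<inter> E))
      \<le> 2 * real (card used_rows) * (real m + 2)
          * (real (card D) ^ p * real (card used_rows) powr surplus (k + p))"
proof -
  define T where "T = card (touched (1 / real n ^ (k + p)) (word_map w ` unit_square \<inter> E))"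
  define s where "s = card used_rows"
  define t where "t = surplus (k + p)"
  define N where "N = real (card D) ^ p"
  have N0: "N \<ge> 0" by (simp add: N_def)
  have t0: "t \<ge> 0" unfolding t_def by (rule surplus_nonneg)
  have s1: "1 \<le> s" and sm: "s \<le> m" using card_used_rows_pos card_used_rows_le by (auto simp: s_def)
  define l where "l = extra (k + p)"
  have l: "real l \<le> t" "t < real l + 1" using extra_bounds by (auto simp: l_def t_def)
  have sl: "real s ^ l \<le> real s powr t" using rows_power_bounds(1) by (simp add: s_def l_def t_def)
  have sl1: "1 \<le> real s ^ l" using s1 by (intro one_le_power) linarith
  have ratio: "real n ^ (k + p) / real m ^ (k + p + i) = real m powr (t - real i)" for i
    using square_ratio[of "k + p" i] by (simp add: t_def)
  have crude: "real n ^ (k + p) / real m ^ (k + p + l) + 1 < real (m + 1)"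
    using extra_ratio(2)[of "k + p"] by (simp add: l_def)
  have sharp: "real T \<le> (5 * real \<rho> * real s ^ i + 10) * N"
    if "p > 0" "real m powr (t - real i) + 1 < real \<rho>" for \<rho> i
  proof -
    have "T \<le> (5 * \<rho> * s ^ i + 10) * card D ^ p"
      unfolding T_def s_def using that(2) by (intro touched_upper_pos[OF w refl that(1)]) (simp only: ratio)
    then have "real T \<le> real ((5 * \<rho> * s ^ i + 10) * card D ^ p)" by (rule of_nat_mono)
    then show ?thesis by (simp add: N_def)
  qed
  have finish: "real T \<le> 2 * real s * (real m + 2) * (N * real s powr t)"
    if "real T \<le> B * N" "B \<le> 2 * real s * (real m + 2) * real s powr t" for B
    using order_trans[OF that(1) mult_right_mono[OF that(2) N0]] by (simp add: mult_ac)
  have "real T \<le> 2 * real s * (real m + 2) * (N * real s powr t)"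
  proof (cases "s = 1")
    case True
    have "T \<le> 8 * card D ^ p"
      unfolding T_def using True by (intro touched_one_row[OF w refl]) (simp add: s_def)
    then have "real T \<le> real (8 * card D ^ p)" by (rule of_nat_mono)
    then have "real T \<le> 8 * N" by (simp add: N_def)
    then show ?thesis using True m_ge_2 by (intro finish) auto
  next
    case False
    then have s2: "2 \<le> s" using s1 by simp
    show ?thesis
    proof (cases "p = 0")
      case True
      have "T \<le> 3 * (m + 1) * s ^ l + (if l = 0 then 0 else 12)"
        using touched_upper_0[OF w refl, of l "m + 1"] crude True by (simp add: T_def s_def)
      then have "real T \<le> real (3 * (m + 1) * s ^ l + (if l = 0 then 0 else 12))" by (rule of_nat_mono)
      also have "\<dots> \<le> 4 * (real m + 2) * real s ^ l"
      proof (cases "l = 0")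
        case False
        then have "real s ^ 1 \<le> real s ^ l" using s1 by (intro power_increasing) auto
        moreover have "2 \<le> real s ^ 1" using s2 by simp
        ultimately have "2 \<le> real s ^ l" by (rule order_trans[rotated])
        moreover have "0 \<le> (real m - 1) * real s ^ l" using m_ge_2 by simp
        ultimately show ?thesis using False by (simp add: algebra_simps)
      qed simp
      finally have "real T \<le> (4 * (real m + 2) * real s ^ l) * N" using True by (simp add: N_def)
      moreover have "4 * (real m + 2) * real s ^ l \<le> 2 * real s * (real m + 2) * real s powr t"
        using sl s2 by (intro mult_mono) auto
      ultimately show ?thesis by (rule finish)
    next
      case False
      then have p: "p > 0" by simp
      \<comment> \<open>Both \<open>k\<close> and \<open>p\<close> are positive here, which keeps \<open>m\<^sup>t = (n/m)\<^sup>q\<close> away from \<open>1\<close>.\<close>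
      have q2: "2 \<le> k + p" using k p by simp
      have nm: "real n / real m \<ge> (real m + 1) / real m"
        using m_less_n m_ge_2 by (intro divide_right_mono) auto
      have "((real m + 1) / real m)\<^sup>2 \<le> (real n / real m)\<^sup>2" using nm by (intro power_mono) auto
      also have "\<dots> \<le> (real n / real m) ^ (k + p)"
        using q2 m_less_n m_ge_2 by (intro power_increasing) auto
      finally have g: "((real m + 1) / real m)\<^sup>2 \<le> real m powr t"
        using powr_surplus[of "k + p"] by (simp add: t_def)
      define \<rho> where "\<rho> = (\<lambda>i::nat. nat \<lfloor>real m powr (t - real i)\<rfloor> + 2)"
      have \<rho>: "real m powr (t - real i) + 1 < real (\<rho> i)" "real (\<rho> i) \<le> real m powr (t - real i) + 2" for i
      proof -
        have "0 \<le> real m powr (t - real i)" by simp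
        then show "real m powr (t - real i) + 1 < real (\<rho> i)" "real (\<rho> i) \<le> real m powr (t - real i) + 2"
          unfolding \<rho>_def by linarith+
      qed
      consider "3 \<le> s" | "s = 2" "m = 2" | "s = 2" "3 \<le> m" "1 \<le> l" | "s = 2" "3 \<le> m" "l = 0"
        using s2 m_ge_2 by linarith
      then show ?thesis
      proof cases
        case 1
        have "real T \<le> (5 * real (m + 1) * real s ^ l + 10) * N"
          using crude by (intro sharp[OF p]) (simp only: ratio)
        moreover have "5 * real (m + 1) * real s ^ l + 10 \<le> 2 * real s * (real m + 2) * real s powr t"
        proof -
          have "10 \<le> 10 * real s ^ l" using sl1 by simp
          moreover have "3 * real s ^ l \<le> real m * real s ^ l" using 1 sm by (intro mult_right_mono) auto
          ultimately have "5 * real (m + 1) * real s ^ l + 10 \<le> 6 * (real m + 2) * real s ^ l"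
            by (simp add: algebra_simps)
          also have "\<dots> \<le> 2 * real s * (real m + 2) * real s powr t"
            using sl 1 by (intro mult_mono) auto
          finally show ?thesis .
        qed
        ultimately show ?thesis by (rule finish)
      next
        case 2
        \<comment> \<open>All rows are used, so \<open>s\<^sup>t = m\<^sup>t\<close>, and cells of rank \<open>q\<close> without further subdivision do best.\<close>
        have "real T \<le> (5 * real (\<rho> 0) * real s ^ 0 + 10) * N" by (rule sharp[OF p \<rho>(1)])
        moreover have "9 / 4 \<le> 2 powr t" using g by (simp add: 2 power2_eq_square)
        then have "5 * real (\<rho> 0) * real s ^ 0 + 10 \<le> 2 * real s * (real m + 2) * real s powr t"
          using \<rho>(2)[of 0] by (simp add: 2)
        ultimately show ?thesis by (rule finish)
      next
        case 3
        have "real T \<le> (5 * real (\<rho> l) * real s ^ l + 10) * N" by (rule sharp[OF p \<rho>(1)])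
        moreover have "5 * real (\<rho> l) * real s ^ l + 10 \<le> 2 * real s * (real m + 2) * real s powr t"
        proof -
          have "(2::real) ^ 1 \<le> 2 ^ l" using 3 by (intro power_increasing) auto
          then have "5 * real (\<rho> l) * 2 ^ l + 10 \<le> (5 * real (\<rho> l) + 5) * 2 ^ l"
            by (simp add: algebra_simps)
          also have "\<dots> \<le> (5 * (real m powr (t - real l) + 2) + 5) * 2 ^ l"
            using \<rho>(2)[of l] by (intro mult_right_mono) auto
          also have "\<dots> \<le> (4 * (real m + 2) * 2 powr (t - real l)) * 2 ^ l"
            using two_row_budget[of "real m" "t - real l"] 3 l by (intro mult_right_mono) auto
          also have "\<dots> = 4 * (real m + 2) * 2 powr t"
            by (simp add: powr_diff powr_realpow)
          finally show ?thesis by (simp add: 3)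
        qed
        ultimately show ?thesis by (rule finish)
      next
        case 4
        have g': "((real (m + 1)) / real m)\<^sup>2 \<le> real m powr t" using g by (simp add: add.commute)
        note short = two_row_budget_short[OF 4(2) t0 g']
        show ?thesis
        proof (cases "real m powr t < 2")
          case True
          \<comment> \<open>The height in mesh units is less than \<open>2\<close>, so that a cell meets at most three mesh rows.\<close>
          have "real T \<le> (5 * real 3 * real s ^ 0 + 10) * N" using True by (intro sharp[OF p]) simp
          then show ?thesis using short(1) by (intro finish) (auto simp: 4)
        next
          case False
          \<comment> \<open>With one more row the cells are lower than a mesh box and meet at most two mesh rows.\<close>
          have "real m powr (t - real 1) < real m powr 0" using 4 l by (intro powr_less_mono) auto
          then have "real T \<le> (5 * real 2 * real s ^ 1 + 10) * N"
            using 4 by (intro sharp[OF p]) simp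
          moreover have "30 \<le> 4 * (real m + 2) * 2 powr t" using short(2,3) False by fastforce
          ultimately show ?thesis by (intro finish) (auto simp: 4)
        qed
      qed
    qed
  qed
  then show ?thesis by (simp only: T_def s_def t_def N_def)
qed

end

section \<open>Mesh boxes meeting a basic rectangle\<close>

theorem theorem2p1:
  fixes n m k p s :: nat
    and D :: "(nat \<times> nat) set"
    and E R :: "(real \<times> real) set"
    and \<mu> :: "(real \<times> real) measure"
    and \<delta> C\<^sub>2 :: real
  assumes "2 \<le> m" and "m < n"
    and "carpet_digits n m D"
    and "is_carpet n m D E"
    and "uniform_bernoulli_measure n m D E \<mu>"
    and "s = card {j \<in> {0..<m}. distribution_seq D j > 0}"
    and "1 \<le> k"
    and "basic_rectangle n m D k R"
    and "\<delta> = 1 / real n ^ (k + p)"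
    and "C\<^sub>2 = 2 * real s * (real m + 2)"
  shows "inverse C\<^sub>2 * measure \<mu> R * \<delta> powr (- box_dim E) \<le> real (mesh_count \<delta> (R \<inter> E)) \<and>
         real (mesh_count \<delta> (R \<inter> E)) \<le> C\<^sub>2 * measure \<mu> R * \<delta> powr (- box_dim E)"
proof -
  interpret carpet n m D E by unfold_locales (use assms in auto)
  obtain w where w: "w \<in> words D k" and R: "R = word_map w ` unit_square"
    using assms(8) by (auto simp: basic_rectangle_def words_def)
  let ?s = "real (card used_rows)"
  have "{j \<in> {0..<m}. distribution_seq D j > 0} = used_rows"
  proof -
    have "finite {i. (i, j) \<in> D}" for j
      by (rule finite_subset[of _ "fst ` D"]) force+
    then have "distribution_seq D j > 0 \<longleftrightarrow> j \<in> used_rows" for j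
      by (force simp: distribution_seq_def card_gt_0_iff)
    then show ?thesis using used_rows_sub by auto
  qed
  then have s: "s = card used_rows" using assms(6) by simp
  have s0: "?s > 0" using card_used_rows_pos by simp
  have \<delta>0: "\<delta> > 0" using assms(9) n_ge_3 by simp
  define M where "M = real (card (touched \<delta> (word_map w ` unit_square \<inter> E)))"
  have count: "real (mesh_count \<delta> (R \<inter> E)) = M"
    unfolding M_def R by (simp add: mesh_count_eq_card_touched[OF \<delta>0])
  define X where "X = real (card D) ^ p * ?s powr surplus (k + p)"
  have "measure \<mu> R = 1 / real (card D) ^ k"
    using measure_basic_rectangle[OF assms(5), of w] w by (simp add: R words_def)
  moreover have "\<delta> powr (- box_dim E) = real (card D) ^ (k + p) * ?s powr surplus (k + p)"
    unfolding box_dim_eq assms(9) by (rule scale_powr_dim)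
  ultimately have X: "measure \<mu> R * \<delta> powr (- box_dim E) = X"
    using card_D_pos by (simp add: X_def power_add)
  have C: "C\<^sub>2 = 2 * ?s * (real m + 2)" and C0: "C\<^sub>2 > 0"
    using s0 by (simp_all add: assms(10) s)
  \<comment> \<open>The factor \<open>s\<close> is lost by rounding \<open>t\<close> down to the integer \<open>l\<close>.\<close>
  have "X \<le> 3 * ?s * M"
    using touched_lower_powr[OF w, of p] by (simp add: X_def M_def assms(9))
  also have "\<dots> \<le> C\<^sub>2 * M"
  proof (rule mult_right_mono)
    have "?s * 3 \<le> ?s * (2 * (real m + 2))" using s0 by (intro mult_left_mono) auto
    then show "3 * ?s \<le> C\<^sub>2" by (simp add: C algebra_simps)
  qed (simp add: M_def)
  finally have "inverse C\<^sub>2 * X \<le> M" using C0 by (simp add: field_simps)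
  moreover have "M \<le> C\<^sub>2 * X"
    using touched_upper_powr[OF w, of p] assms(7) by (simp add: X_def M_def C assms(9))
  ultimately show ?thesis unfolding count by (simp add: X mult.assoc)
qed

end
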